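(* Let $\Delta$ be a unit-interval simplicial complex on $[n]$ with $\dim(\Delta)=d-1>1$, let $\omega(\Delta)$ be the clique number of $\Delta$, and let $\Gamma=\mathrm{Ind}(\Delta)$. Then $$a(R_\Gamma)\le\begin{cases}-\left\lceil\frac{\omega(\Delta)}{d-1}\right\rceil&\text{if }d-1\text{ does not divide }\omega(\Delta),\\[2pt]-\left\lceil\frac{\omega(\Delta)}{d-1}\right\rceil-1&\text{if }d-1\text{ divides }\omega(\Delta).\end{cases}$$ If the set of height one monomial prime ideals of $R_\Gamma$ containing $t$ is equal to $\{P_i:i=1,\dots,n\}\cup\{L_j:j=1,\dots,m\}$, where $B_1,\dots,B_m$ are the maximal cliques of $\Delta$, $P_i=(\mathbf{x}_Ft:F\in\Gamma,\ i\notin F)\subset R_\Gamma$ and $L_j=(\mathbf{x}_Ft:F\in\Gamma,\ |F\cap B_j|<d-1)\subset R_\Gamma$, then this inequality is an equality.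
   Context: For a pure $(d-1)$-dimensional simplicial complex $\Delta$ on vertex set $[n]$: a clique is a subset $C\subseteq[n]$ all of whose $d$-subsets are facets of $\Delta$; the clique number $\omega(\Delta)$ is the largest size of a clique; $\mathrm{Ind}(\Delta)$ is the simplicial complex of all subsets of $[n]$ containing no facet of $\Delta$. $\Delta$ is a unit-interval simplicial complex if it is pure and for every facet $\{i_1<\cdots<i_d\}$ the interval $[i_1,i_d]=\{i_1,i_1+1,\dots,i_d\}$ is a clique of $\Delta$. "Maximal cliques of $\Delta$" means the inclusion-maximal cliques with at least $d$ elements; these are intervals. Let $K$ be a field, $S=K[x_1,\dots,x_n]$, $\mathbf{x}_F=\prod_{i\in F}x_i$ ($\mathbf{x}_\emptyset=1$), and $R_\Gamma=K[\mathbf{x}_Ft:F\in\Gamma]\subset S[t]$, a normal Cohen-Macaulay domain, standard graded by $\deg(x_1^{a_1}\cdots x_n^{a_n}t^k)=k$. A monomial ideal of $R_\Gamma$ is an ideal generated by monomials $x_1^{a_1}\cdots x_n^{a_n}t^k\in R_\Gamma$. The canonical module $\omega_{R_\Gamma}$ is identified with the graded ideal which is the intersection of all height one monomial prime ideals of $R_\Gamma$. The $a$-invariant is $a(R)=-\min\{j:(\omega_R)_j\ne0\}$. *)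

theory Defs
  imports
    "HOL-Algebra.Algebraic_Closure_Type"
    "HOL-Algebra.Generated_Rings"
    "HOL-Computational_Algebra.Polynomial"
    "HOL-Library.Poly_Mapping"
    "HOL-Library.Extended_Nat"
begin

section \<open>Simplicial complexes on \<open>{1..n}\<close>\<close>

text \<open>Every element of the vertex set is a vertex; excluding the void complex
  makes the maximum in \<open>complex_dim\<close> meaningful.\<close>

definition simplicial_complex_on :: "'v set \<Rightarrow> 'v set set \<Rightarrow> bool" where
  "simplicial_complex_on V \<Delta> \<longleftrightarrow>
     \<Delta> \<noteq> {} \<and> \<Delta> \<subseteq> Pow V \<and> (\<forall>v\<in>V. {v} \<in> \<Delta>) \<and> (\<forall>F\<in>\<Delta>. \<forall>G. G \<subseteq> F \<longrightarrow> G \<in> \<Delta>)"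

definition facets :: "'v set set \<Rightarrow> 'v set set" where
  "facets \<Delta> = {F \<in> \<Delta>. \<forall>G\<in>\<Delta>. F \<subseteq> G \<longrightarrow> F = G}"

definition complex_dim :: "'v set set \<Rightarrow> int" where
  "complex_dim \<Delta> = int (Max (card ` \<Delta>)) - 1"

definition pure_complex :: "'v set set \<Rightarrow> bool" where
  "pure_complex \<Delta> \<longleftrightarrow> (\<forall>F\<in>facets \<Delta>. \<forall>G\<in>facets \<Delta>. card F = card G)"

definition cliques :: "nat \<Rightarrow> nat \<Rightarrow> nat set set \<Rightarrow> nat set set" where
  "cliques n d \<Delta> = {C. C \<subseteq> {1..n} \<and> (\<forall>F. F \<subseteq> C \<and> card F = d \<longrightarrow> F \<in> facets \<Delta>)}"

definition clique_number :: "nat \<Rightarrow> nat \<Rightarrow> nat set set \<Rightarrow> nat" where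
  "clique_number n d \<Delta> = Max (card ` cliques n d \<Delta>)"

text \<open>Sets with fewer than \<open>d\<close> elements are vacuously cliques, hence the size bound.\<close>

definition maximal_cliques :: "nat \<Rightarrow> nat \<Rightarrow> nat set set \<Rightarrow> nat set set" where
  "maximal_cliques n d \<Delta> =
     {B \<in> cliques n d \<Delta>. d \<le> card B \<and> (\<forall>C\<in>cliques n d \<Delta>. B \<subseteq> C \<longrightarrow> B = C)}"

definition unit_interval_complex :: "nat \<Rightarrow> nat set set \<Rightarrow> bool" where
  "unit_interval_complex n \<Delta> \<longleftrightarrow>
     simplicial_complex_on {1..n} \<Delta> \<and> pure_complex \<Delta> \<and>
     (\<forall>F\<in>facets \<Delta>. {Min F..Max F} \<in> cliques n (card F) \<Delta>)"

definition Ind :: "nat \<Rightarrow> nat set set \<Rightarrow> nat set set" where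
  "Ind n \<Delta> = {A. A \<subseteq> {1..n} \<and> (\<forall>F\<in>facets \<Delta>. \<not> F \<subseteq> A)}"


section \<open>The toric ring \<open>K[x\<^sub>F t : F \<in> \<Gamma>]\<close>\<close>

text \<open>The polynomial ring \<open>S\<close> is realised with variables \<open>x\<^sub>i\<close> for all natural numbers \<open>i\<close>; for
  \<open>\<Gamma>\<close> on \<open>{1..n}\<close> the ring generated below involves only \<open>x\<^sub>1, \<dots>, x\<^sub>n\<close> and \<open>t\<close>.  The variable of
  the outer polynomial type is \<open>t\<close>, so \<open>Polynomial.monom f k\<close> is \<open>f t\<^sup>k\<close>.\<close>

type_synonym 'k S = "(nat \<Rightarrow>\<^sub>0 nat) \<Rightarrow>\<^sub>0 'k"

definition xvar :: "nat \<Rightarrow> 'k::field S" where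
  "xvar i = Poly_Mapping.single (Poly_Mapping.single i 1) 1"

definition xset :: "nat set \<Rightarrow> 'k::field S" where
  "xset F = (\<Prod>i\<in>F. xvar i)"

abbreviation xset_t :: "nat set \<Rightarrow> 'k::field S poly" where
  "xset_t F \<equiv> Polynomial.monom (xset F) 1"

definition tvar :: "'k::field S poly" where
  "tvar = Polynomial.monom 1 1"

definition scalars :: "'k::field S poly set" where
  "scalars = range (\<lambda>c. Polynomial.monom (Poly_Mapping.single 0 c) 0)"

definition toric_ring :: "nat set set \<Rightarrow> 'k::field S poly ring" where
  "toric_ring \<Gamma> = ring_of_type_algebra
     \<lparr>carrier := generate_ring ring_of_type_algebra (scalars \<union> xset_t ` \<Gamma>)\<rparr>"

definition monomials :: "'k::field S poly set" where
  "monomials = {Polynomial.monom (Poly_Mapping.single a 1) k | a k. True}"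


section \<open>Monomial primes, canonical ideal and \<open>a\<close>-invariant\<close>

definition monomial_ideal :: "'k::field S poly set \<Rightarrow> 'k S poly ring \<Rightarrow> bool" where
  "monomial_ideal I R \<longleftrightarrow> (\<exists>M \<subseteq> carrier R \<inter> monomials. I = genideal R M)"

text \<open>The supremum of the lengths \<open>k\<close> of chains \<open>C 0 \<subset> \<dots> \<subset> C k = P\<close> of prime ideals.\<close>

definition prime_height :: "('a, 'b) ring_scheme \<Rightarrow> 'a set \<Rightarrow> enat" where
  "prime_height R P = Sup {enat k | k. \<exists>C :: nat \<Rightarrow> 'a set.
     (\<forall>i\<le>k. primeideal (C i) R) \<and> (\<forall>i<k. C i \<subset> C (Suc i)) \<and> C k = P}"

definition height_one_monomial_primes :: "'k::field S poly ring \<Rightarrow> 'k S poly set set" where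
  "height_one_monomial_primes R =
     {P. primeideal P R \<and> monomial_ideal P R \<and> prime_height R P = 1}"

text \<open>The canonical module of a normal toric ring, as an ideal of that ring.\<close>

definition canonical_ideal :: "'k::field S poly ring \<Rightarrow> 'k S poly set" where
  "canonical_ideal R = carrier R \<inter> \<Inter> (height_one_monomial_primes R)"

text \<open>As \<open>x\<^sup>a t\<^sup>k\<close> has degree \<open>k\<close>, the homogeneous elements of degree \<open>j\<close> are those of the form
  \<open>f t\<^sup>j\<close> with \<open>f \<in> S\<close>.\<close>

definition a_invariant :: "'k::field S poly ring \<Rightarrow> int" where
  "a_invariant R =
     - int (LEAST j. \<exists>f. f \<noteq> 0 \<and> Polynomial.monom f j \<in> canonical_ideal R)"

definition P_ideal :: "nat set set \<Rightarrow> nat \<Rightarrow> 'k::field S poly set" where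
  "P_ideal \<Gamma> i = genideal (toric_ring \<Gamma>) (xset_t ` {F \<in> \<Gamma>. i \<notin> F})"

definition L_ideal :: "nat set set \<Rightarrow> nat \<Rightarrow> nat set \<Rightarrow> 'k::field S poly set" where
  "L_ideal \<Gamma> d B = genideal (toric_ring \<Gamma>) (xset_t ` {F \<in> \<Gamma>. card (F \<inter> B) < d - 1})"

end

theory Submission
  imports Defs "HOL-Library.Product_Plus"
begin

text \<open>
  A nonzero element of the canonical ideal of degree \<open>k\<close> lies in the primes of the facets \<open>a\<^sub>i = 0\<close> and
  \<open>\<Sum>\<^bsub>i \<in> B\<^esub> a\<^sub>i = k(d - 1)\<close> of the exponent cone, where \<open>B\<close> is a clique of size \<open>\<omega>\<close>.  Hence its monomials satisfy
  \<open>a\<^sub>i \<ge> 1\<close> and \<open>\<omega> \<le> \<Sum>\<^bsub>i \<in> B\<^esub> a\<^sub>i < k(d - 1)\<close>, so \<open>k \<ge> q\<close> with \<open>q = \<lfloor>\<omega>/(d - 1)\<rfloor> + 1\<close>.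
  Conversely \<open>x\<^sub>1 \<cdots> x\<^sub>n t\<^sup>q\<close> is in the ring: a residue class modulo \<open>q\<close> contains no facet, because the interval
  spanned by such a facet would be a clique with more than \<open>q(d - 1) > \<omega>\<close> elements.  This monomial lies in all
  \<open>P\<^sub>i\<close> and \<open>L\<^sub>j\<close>, and also in every monomial prime without \<open>t\<close>, since \<open>x\<^sub>F t \<cdot> t = x\<^sub>i t \<cdot> x\<^bsub>F - i\<^esub> t\<close> shows
  that such a prime contains all generators \<open>x\<^sub>F t\<close> with \<open>i \<in> F\<close>, for some \<open>i\<close>.
\<close>

section \<open>Monomials of \<open>S[t]\<close>\<close>

type_synonym expvec = "(nat \<Rightarrow>\<^sub>0 nat) \<times> nat"

text \<open>Flattens the two layers of S[t]: an element becomes a finitely supported function on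
  pairs (a, k), so that monomials form one cancellative additive monoid.\<close>

definition mcoeff :: "'k::field S poly \<Rightarrow> expvec \<Rightarrow> 'k" where
  "mcoeff f p = Poly_Mapping.lookup (Polynomial.coeff f (snd p)) (fst p)"

definition supp :: "'k::field S poly \<Rightarrow> expvec set" where
  "supp f = {p. mcoeff f p \<noteq> 0}"

definition xt_monom :: "expvec \<Rightarrow> 'k::field S poly" where
  "xt_monom p = Polynomial.monom (Poly_Mapping.single (fst p) 1) (snd p)"

definition scalar :: "'k::field \<Rightarrow> 'k S poly" where
  "scalar c = Polynomial.monom (Poly_Mapping.single 0 c) 0"

lemma mcoeff_add: "mcoeff (f + g) p = mcoeff f p + mcoeff g p"
  by (simp add: mcoeff_def lookup_add)

lemma mcoeff_uminus: "mcoeff (- f) p = - mcoeff f p"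
  by (simp add: mcoeff_def)

lemma mcoeff_sum: "mcoeff (sum f J) p = (\<Sum>x\<in>J. mcoeff (f x) p)"
  by (simp add: mcoeff_def Polynomial.coeff_sum lookup_sum)

lemma mcoeff_0: "mcoeff 0 p = 0"
  by (simp add: mcoeff_def)

lemma poly_eqI_mcoeff: "(\<And>p. mcoeff f p = mcoeff g p) \<Longrightarrow> f = g"
  unfolding mcoeff_def by (intro Polynomial.poly_eqI poly_mapping_eqI) (metis fst_conv snd_conv)

lemma xt_monom_mult: "xt_monom p * xt_monom q = xt_monom (p + q)"
  by (simp add: xt_monom_def Polynomial.mult_monom mult_single)

lemma xt_monom_0: "xt_monom 0 = 1"
  by (simp add: xt_monom_def Polynomial.monom_eq_1_iff)

lemma scalar_mult_xt_monom: "scalar c * xt_monom p = Polynomial.monom (Poly_Mapping.single (fst p) c) (snd p)"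
  by (simp add: xt_monom_def scalar_def Polynomial.mult_monom mult_single)

lemma mcoeff_scalar_mult_xt_monom: "mcoeff (scalar c * xt_monom p) q = (if q = p then c else 0)"
  by (auto simp: scalar_mult_xt_monom mcoeff_def Polynomial.coeff_monom lookup_single when_def prod_eq_iff)

lemma mcoeff_xt_monom: "mcoeff (xt_monom p) q = (if q = p then 1 else 0)"
  using mcoeff_scalar_mult_xt_monom[of 1 p q] by (simp add: scalar_def flip: one_pCons)

lemma supp_xt_monom: "supp (xt_monom p :: 'k::field S poly) = {p}"
  by (auto simp: supp_def mcoeff_xt_monom)

lemma finite_supp: "finite (supp f)"
proof -
  have "supp f \<subseteq> (\<Union>k\<le>Polynomial.degree f. Poly_Mapping.keys (Polynomial.coeff f k) \<times> {k})"
  proof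
    fix p assume "p \<in> supp f"
    then have *: "Poly_Mapping.lookup (Polynomial.coeff f (snd p)) (fst p) \<noteq> 0"
      by (simp add: supp_def mcoeff_def)
    then have "Polynomial.coeff f (snd p) \<noteq> 0" by auto
    then have "snd p \<le> Polynomial.degree f" by (rule Polynomial.le_degree)
    with * show "p \<in> (\<Union>k\<le>Polynomial.degree f. Poly_Mapping.keys (Polynomial.coeff f k) \<times> {k})"
      by (auto simp: in_keys_iff intro!: bexI[of _ "snd p"] simp: mem_Times_iff)
  qed
  then show ?thesis by (rule finite_subset) auto
qed

lemma mcoeff_sum_terms:
  "finite J \<Longrightarrow> mcoeff (\<Sum>p\<in>J. scalar (c p) * xt_monom p) q = (if q \<in> J then c q else 0)"
  by (simp add: mcoeff_sum mcoeff_scalar_mult_xt_monom)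

lemma sum_terms: "f = (\<Sum>p\<in>supp f. scalar (mcoeff f p) * xt_monom p)"
  by (rule poly_eqI_mcoeff) (simp add: mcoeff_sum_terms finite_supp, simp add: supp_def)

lemma supp_eq_empty: "supp f = {} \<longleftrightarrow> f = 0"
proof
  show "f = 0" if "supp f = {}"
    using sum_terms[of f] unfolding that by simp
qed (simp add: supp_def mcoeff_0)

lemma supp_add: "supp (f + g) \<subseteq> supp f \<union> supp g"
  by (auto simp: supp_def mcoeff_add)

lemma supp_uminus: "supp (- f) = supp f"
  by (auto simp: supp_def mcoeff_uminus)

text \<open>Expanding both factors into terms turns the coefficient at \<open>r\<close> into a sum
  over pairs adding up to \<open>r\<close>; a nonzero sum has a nonzero summand.\<close>

lemma supp_mult:
  assumes "r \<in> supp (f * g)"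
  obtains p q where "p \<in> supp f" "q \<in> supp g" "r = p + q"
proof -
  have "f * g = (\<Sum>p\<in>supp f. \<Sum>q\<in>supp g. scalar (mcoeff f p) * xt_monom p * (scalar (mcoeff g q) * xt_monom q))"
    using sum_product[of "\<lambda>p. scalar (mcoeff f p) * xt_monom p" "supp f" "\<lambda>p. scalar (mcoeff g p) * xt_monom p" "supp g"]
    by (simp flip: sum_terms)
  also have "\<dots> = (\<Sum>p\<in>supp f. \<Sum>q\<in>supp g. scalar (mcoeff f p * mcoeff g q) * xt_monom (p + q))"
    by (simp add: scalar_mult_xt_monom Polynomial.mult_monom mult_single)
  finally have "mcoeff (f * g) r = (\<Sum>p\<in>supp f. \<Sum>q\<in>supp g. if r = p + q then mcoeff f p * mcoeff g q else 0)"
    by (simp add: mcoeff_sum mcoeff_scalar_mult_xt_monom)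
  with assms have "(\<Sum>p\<in>supp f. \<Sum>q\<in>supp g. if r = p + q then mcoeff f p * mcoeff g q else 0) \<noteq> 0"
    by (simp add: supp_def)
  from this obtain p where p: "p \<in> supp f" "(\<Sum>q\<in>supp g. if r = p + q then mcoeff f p * mcoeff g q else 0) \<noteq> 0"
    by (rule sum.not_neutral_contains_not_neutral)
  from p(2) obtain q where "q \<in> supp g" "(if r = p + q then mcoeff f p * mcoeff g q else 0) \<noteq> 0"
    by (rule sum.not_neutral_contains_not_neutral)
  with p show thesis by (intro that) (auto split: if_splits)
qed

text \<open>Exponents can be cancelled, so a monomial factor shifts the coefficients without merging
  terms.\<close>

lemma mcoeff_mult_xt_monom: "mcoeff (f * xt_monom q) (p + q) = mcoeff f p"
proof -
  have "f * xt_monom q = (\<Sum>p\<in>supp f. scalar (mcoeff f p) * xt_monom p) * xt_monom q"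
    by (simp flip: sum_terms)
  also have "\<dots> = (\<Sum>p\<in>supp f. scalar (mcoeff f p) * xt_monom (p + q))"
    by (simp add: sum_distrib_right mult.assoc xt_monom_mult)
  finally show ?thesis
    by (simp add: mcoeff_sum mcoeff_scalar_mult_xt_monom finite_supp) (simp add: supp_def)
qed

definition face_vec :: "nat set \<Rightarrow> expvec" where
  "face_vec F = (\<Sum>i\<in>F. Poly_Mapping.single i 1, 1)"

lemma xset_t_eq: "finite F \<Longrightarrow> xset_t F = xt_monom (face_vec F)"
proof (induction F rule: finite_induct)
  case (insert i F)
  then show ?case
    by (simp add: xt_monom_def face_vec_def xset_def xvar_def Polynomial.monom_eq_iff)
       (metis mult_single mult.right_neutral)
qed (simp_all add: xset_def face_vec_def xt_monom_def)

lemma tvar_eq: "tvar = xt_monom (face_vec {})"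
  by (simp add: tvar_def xt_monom_def face_vec_def)

section \<open>The toric ring as a monoid algebra\<close>

text \<open>Generators are added one at a time, so that induction peels a single factor x_F t off a
  monomial.\<close>

inductive_set expo :: "nat set set \<Rightarrow> expvec set" for \<Gamma> where
  zero: "0 \<in> expo \<Gamma>"
| step: "\<lbrakk>p \<in> expo \<Gamma>; F \<in> \<Gamma>\<rbrakk> \<Longrightarrow> p + face_vec F \<in> expo \<Gamma>"

lemma expo_face_vec: "F \<in> \<Gamma> \<Longrightarrow> face_vec F \<in> expo \<Gamma>"
  using expo.step[OF expo.zero] by simp

lemma expo_add: 
  assumes "p \<in> expo \<Gamma>" "q \<in> expo \<Gamma>" shows "p + q \<in> expo \<Gamma>"
  using assms(2,1) by (induction) (auto simp: expo.step simp flip: add.assoc)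

lemma expo_sum: "(\<And>x. x \<in> J \<Longrightarrow> f x \<in> expo \<Gamma>) \<Longrightarrow> sum f J \<in> expo \<Gamma>"
  by (induction J rule: infinite_finite_induct) (auto simp: expo.zero expo_add)

definition toric_set :: "nat set set \<Rightarrow> 'k::field S poly set" where
  "toric_set \<Gamma> = {f. supp f \<subseteq> expo \<Gamma>}"

lemma xt_monom_in_toric_set: "xt_monom p \<in> (toric_set \<Gamma> :: 'k::field S poly set) \<longleftrightarrow> p \<in> expo \<Gamma>"
  by (simp add: toric_set_def supp_xt_monom)

lemma scalar_in_toric_set: "scalar c \<in> toric_set \<Gamma>"
  using mcoeff_scalar_mult_xt_monom[of c 0]
  by (auto simp: toric_set_def supp_def xt_monom_0 expo.zero split: if_splits)

lemma toric_set_add: "f \<in> toric_set \<Gamma> \<Longrightarrow> g \<in> toric_set \<Gamma> \<Longrightarrow> f + g \<in> toric_set \<Gamma>"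
  using supp_add by (fastforce simp: toric_set_def)

lemma toric_set_mult: "f \<in> toric_set \<Gamma> \<Longrightarrow> g \<in> toric_set \<Gamma> \<Longrightarrow> f * g \<in> toric_set \<Gamma>"
  unfolding toric_set_def mem_Collect_eq
proof
  fix r
  assume fg: "supp f \<subseteq> expo \<Gamma>" "supp g \<subseteq> expo \<Gamma>" and "r \<in> supp (f * g)"
  then obtain p q where "p \<in> supp f" "q \<in> supp g" "r = p + q" by (elim supp_mult)
  with fg show "r \<in> expo \<Gamma>" by (auto intro: expo_add)
qed

lemma toric_set_uminus: "f \<in> toric_set \<Gamma> \<Longrightarrow> - f \<in> toric_set \<Gamma>"
  by (simp add: toric_set_def supp_uminus)

lemma toric_set_1: "1 \<in> toric_set \<Gamma>"
  using xt_monom_in_toric_set[of 0 \<Gamma>] by (simp add: xt_monom_0 expo.zero)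

lemma toric_set_0: "0 \<in> toric_set \<Gamma>"
  by (simp add: toric_set_def supp_def mcoeff_0)

lemma type_ring_simps [simp]:
  "x \<otimes>\<^bsub>ring_of_type_algebra\<^esub> y = x * y"
  "x \<oplus>\<^bsub>ring_of_type_algebra\<^esub> y = x + y"
  "\<one>\<^bsub>ring_of_type_algebra\<^esub> = 1"
  "\<zero>\<^bsub>ring_of_type_algebra\<^esub> = 0"
  "carrier ring_of_type_algebra = UNIV"
  by (simp_all add: ring_of_type_algebra_def)

lemma type_ring_uminus [simp]: "\<ominus>\<^bsub>ring_of_type_algebra\<^esub> (x::'a::comm_ring_1) = - x"
proof -
  interpret ring "ring_of_type_algebra :: 'a ring" by (rule ring_from_type_algebra)
  show ?thesis by (rule minus_equality) auto
qed

text \<open>The generated ring contains all products of generators, hence all their K-combinations;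
  conversely these combinations are closed under the ring operations. Membership in the ring thereby
  becomes a condition on supports.\<close>

lemma generate_toric:
  assumes "\<And>F. F \<in> \<Gamma> \<Longrightarrow> finite F"
  shows "generate_ring ring_of_type_algebra (scalars \<union> xset_t ` \<Gamma>) = (toric_set \<Gamma> :: 'k::field S poly set)"
proof -
  let ?H = "range scalar \<union> (\<lambda>F. xt_monom (face_vec F)) ` \<Gamma> :: 'k S poly set"
  let ?G = "generate_ring ring_of_type_algebra ?H"
  have H: "scalars \<union> xset_t ` \<Gamma> = ?H"
    unfolding scalars_def scalar_def using assms by (intro arg_cong2[where f = "(\<union>)"] image_cong refl xset_t_eq)
  have xt_monom: "xt_monom p \<in> ?G" if "p \<in> expo \<Gamma>" for p
    using that
  proof induction
    case zero
    then show ?case using generate_ring.one[of ring_of_type_algebra] by (simp add: xt_monom_0)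
  next
    case (step p F)
    then have "xt_monom (face_vec F) \<in> ?G" by (auto intro: generate_ring.incl)
    with step generate_ring.eng_mult[of "xt_monom p" ring_of_type_algebra _ "xt_monom (face_vec F)"]
    show ?case by (simp add: xt_monom_mult)
  qed
  have scalar: "scalar c \<in> ?G" for c
    by (auto intro: generate_ring.incl)
  have zero: "0 \<in> ?G"
    using scalar[of 0] by (simp add: scalar_def)
  have sum: "(\<Sum>p\<in>J. scalar (mcoeff f p) * xt_monom p) \<in> ?G" if "finite J" "J \<subseteq> expo \<Gamma>" for J and f :: "'k S poly"
    using that
  proof (induction J rule: finite_induct)
    case (insert p J)
    then have "scalar (mcoeff f p) * xt_monom p \<in> ?G"
      using generate_ring.eng_mult[OF scalar xt_monom] by simp
    with insert generate_ring.eng_add[of _ ring_of_type_algebra ?H] show ?case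
      by (metis (no_types, lifting) insert_subset sum.insert type_ring_simps(2))
  qed (simp add: zero)
  have "f \<in> ?G" if "f \<in> toric_set \<Gamma>" for f :: "'k S poly"
    using sum[of "supp f" f] that
    by (simp add: finite_supp toric_set_def flip: sum_terms)
  moreover have "f \<in> toric_set \<Gamma>" if "f \<in> ?G" for f
    using that
    by induction (auto simp: toric_set_1 toric_set_add toric_set_mult toric_set_uminus
        scalar_in_toric_set xt_monom_in_toric_set expo_face_vec)
  ultimately show ?thesis
    unfolding H by (intro equalityI subsetI)
qed

section \<open>Ideals and prime heights in the toric ring\<close>

locale toric =
  fixes \<Gamma> :: "nat set set" and R :: "'k::field S poly ring"
  assumes finite_face: "F \<in> \<Gamma> \<Longrightarrow> finite F"
    and R_eq: "R = toric_ring \<Gamma>"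
begin

lemma R_simps [simp]:
  "carrier R = toric_set \<Gamma>" "x \<otimes>\<^bsub>R\<^esub> y = x * y" "x \<oplus>\<^bsub>R\<^esub> y = x + y" "\<one>\<^bsub>R\<^esub> = 1" "\<zero>\<^bsub>R\<^esub> = 0"
  by (simp_all add: R_eq toric_ring_def generate_toric finite_face del: One_nat_def)

sublocale cring R
proof -
  interpret T: ring "ring_of_type_algebra :: 'k S poly ring" by (rule ring_from_type_algebra)
  have "ring R"
    unfolding R_eq toric_ring_def by (rule T.generate_ring_is_ring) simp
  then interpret ring R .
  show "cring R"
    by (intro cring.intro ring_axioms monoid.monoid_comm_monoidI monoid_axioms) (simp add: mult.commute)
qed

lemma toric_idealI:
  assumes "I \<subseteq> toric_set \<Gamma>" "0 \<in> I" "\<And>f g. f \<in> I \<Longrightarrow> g \<in> I \<Longrightarrow> f + g \<in> I"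
    and "\<And>f g. f \<in> I \<Longrightarrow> g \<in> toric_set \<Gamma> \<Longrightarrow> g * f \<in> I"
  shows "ideal I R"
proof (rule idealI)
  show "subgroup I (add_monoid R)"
  proof (rule group.subgroupI[OF a_group])
    show "I \<subseteq> carrier (add_monoid R)" using assms(1) by simp
    show "I \<noteq> {}" using assms(2) by blast
    show "f \<otimes>\<^bsub>add_monoid R\<^esub> g \<in> I" if "f \<in> I" "g \<in> I" for f g
      using assms(3)[OF that] by simp
    fix f assume "f \<in> I"
    \<comment> \<open>Negation is multiplication by -1, which lies in the ring.\<close>
    then have "(- 1) * f \<in> I"
      using assms(4) toric_set_1 toric_set_uminus by blast
    moreover have "\<ominus>\<^bsub>R\<^esub> f = - f"
      using \<open>f \<in> I\<close> assms(1) toric_set_uminus by (intro minus_equality) auto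
    ultimately show "inv\<^bsub>add_monoid R\<^esub> f \<in> I"
      by (simp add: a_inv_def)
  qed
  show "g \<otimes>\<^bsub>R\<^esub> f \<in> I" "f \<otimes>\<^bsub>R\<^esub> g \<in> I" if "f \<in> I" "g \<in> carrier R" for f g
    using assms(4)[of f g] that by (simp_all add: mult.commute)
qed (rule ring_axioms)

lemma ideal_0: "ideal I R \<Longrightarrow> 0 \<in> I"
  using additive_subgroup.zero_closed[OF ideal.axioms(1), of I R] by simp

lemma ideal_subset: "ideal I R \<Longrightarrow> I \<subseteq> toric_set \<Gamma>"
  using additive_subgroup.a_subset[OF ideal.axioms(1), of I R] by simp

lemma ideal_add: "ideal I R \<Longrightarrow> f \<in> I \<Longrightarrow> g \<in> I \<Longrightarrow> f + g \<in> I"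
  using additive_subgroup.a_closed[OF ideal.axioms(1), of I R f g] by simp

lemma ideal_mult: "ideal I R \<Longrightarrow> f \<in> I \<Longrightarrow> g \<in> toric_set \<Gamma> \<Longrightarrow> f * g \<in> I"
  using ideal.I_r_closed[of I R f g] by simp

lemma ideal_mult': "ideal I R \<Longrightarrow> f \<in> I \<Longrightarrow> g \<in> toric_set \<Gamma> \<Longrightarrow> g * f \<in> I"
  using ideal.I_l_closed[of I R f g] by simp

lemma ideal_uminus: "ideal I R \<Longrightarrow> f \<in> I \<Longrightarrow> - f \<in> I"
  using ideal_mult'[of I f "- 1"] by (simp add: toric_set_uminus toric_set_1)

lemma ideal_sum: "ideal I R \<Longrightarrow> (\<And>x. x \<in> J \<Longrightarrow> f x \<in> I) \<Longrightarrow> sum f J \<in> I"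
  by (induction J rule: infinite_finite_induct) (auto simp: ideal_0 ideal_add)

lemma prime_ideal: "primeideal P R \<Longrightarrow> ideal P R"
  by (rule primeideal.axioms)

lemma primeD:
  "\<lbrakk>primeideal P R; f * g \<in> P; f \<in> toric_set \<Gamma>; g \<in> toric_set \<Gamma>\<rbrakk> \<Longrightarrow> f \<in> P \<or> g \<in> P"
  using primeideal.I_prime[of P R f g] by simp

lemma prime_1: "primeideal P R \<Longrightarrow> 1 \<notin> P"
  using ideal.one_imp_carrier[OF prime_ideal, of P] primeideal.I_notcarr[of P R] by auto

lemma prime_power: "\<lbrakk>primeideal P R; f ^ m \<in> P; f \<in> toric_set \<Gamma>\<rbrakk> \<Longrightarrow> f \<in> P"
proof (induction m)
  case (Suc m)
  moreover have "f ^ m \<in> toric_set \<Gamma>"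
    using \<open>f \<in> toric_set \<Gamma>\<close> by (induction m) (auto simp: toric_set_1 toric_set_mult)
  ultimately show ?case using primeD[of P f "f ^ m"] by auto
qed (simp add: prime_1)

lemma ideal_memberI:
  assumes "ideal I R" "f \<in> toric_set \<Gamma>" "\<And>p. p \<in> supp f \<Longrightarrow> xt_monom p \<in> I"
  shows "f \<in> I"
proof -
  have "(\<Sum>p\<in>supp f. scalar (mcoeff f p) * xt_monom p) \<in> I"
    using assms by (intro ideal_sum) (auto simp: ideal_mult' scalar_in_toric_set)
  then show ?thesis by (simp flip: sum_terms)
qed

text \<open>The toric ring is a subring of the domain S[t].\<close>

lemma zero_prime: "primeideal {0} R"
proof (rule primeidealI)
  show "ideal {0} R"
    by (rule toric_idealI) (auto simp: toric_set_0)
  show "carrier R \<noteq> {0}"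
    using toric_set_1[of \<Gamma>] by (metis R_simps(1) singletonD zero_neq_one)
qed (simp_all add: is_cring)

text \<open>Every ideal contains 0, so no prime lies strictly below {0} and only chains of length 0
  end there.\<close>

lemma prime_height_pos_nonzero:
  assumes "prime_height R P = 1"
  shows "P \<noteq> {0}"
proof
  assume P: "P = {0}"
  have k0: "k = 0" if "\<forall>i\<le>k. primeideal (C i) R" "\<forall>i<k. C i \<subset> C (Suc i)" "C k = P" for k C
  proof (rule ccontr)
    assume "k \<noteq> 0"
    then obtain j where "k = Suc j" using not0_implies_Suc by blast
    with that P have "C j \<subset> {0}" "primeideal (C j) R" by auto
    with ideal_0[OF prime_ideal] show False by blast
  qed
  then have "prime_height R P \<le> 0"
    unfolding prime_height_def zero_enat_def
  proof (intro Sup_least)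
    fix h
    assume "h \<in> {enat k | k. \<exists>C. (\<forall>i\<le>k. primeideal (C i) R) \<and> (\<forall>i<k. C i \<subset> C (Suc i)) \<and> C k = P}"
    then obtain k C where "h = enat k" "\<forall>i\<le>k. primeideal (C i) R" "\<forall>i<k. C i \<subset> C (Suc i)" "C k = P"
      by (elim CollectE exE conjE)
    then show "h \<le> enat 0" using k0[of k C] by simp
  qed
  with assms show False by simp
qed

text \<open>The chain from {0} to \<open>P\<close> has length one. In a longer chain the prime just
  below \<open>P\<close> properly contains another prime, hence is nonzero, which contradicts
  minimality.\<close>

lemma prime_height_oneI:
  assumes P: "primeideal P R" "P \<noteq> {0}"
    and min: "\<And>P'. primeideal P' R \<Longrightarrow> P' \<noteq> {0} \<Longrightarrow> P' \<subseteq> P \<Longrightarrow> P' = P"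
  shows "prime_height R P = 1"
  unfolding prime_height_def
proof (intro antisym Sup_least Sup_upper)
  have "{0} \<subset> P"
    using P ideal_0[OF prime_ideal[OF P(1)]] by auto
  then have "(\<forall>i\<le>1. primeideal ((\<lambda>i. if i = 0 then {0} else P) i) R) \<and>
      (\<forall>i<1. (\<lambda>i. if i = 0 then {0} else P) i \<subset> (\<lambda>i. if i = 0 then {0} else P) (Suc i)) \<and>
      (\<lambda>i. if i = 0 then {0} else P) (1::nat) = P"
    using P zero_prime by auto
  then show "1 \<in> {enat k | k. \<exists>C. (\<forall>i\<le>k. primeideal (C i) R) \<and> (\<forall>i<k. C i \<subset> C (Suc i)) \<and> C k = P}"
    unfolding one_enat_def by (intro CollectI exI[of _ 1] exI[of _ "\<lambda>i. if i = 0 then {0} else P"] conjI) (auto simp: one_enat_def)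
next
  fix h
  assume "h \<in> {enat k | k. \<exists>C. (\<forall>i\<le>k. primeideal (C i) R) \<and> (\<forall>i<k. C i \<subset> C (Suc i)) \<and> C k = P}"
  then obtain k C where h: "h = enat k" and C': "\<forall>i\<le>k. primeideal (C i) R" "\<forall>i<k. C i \<subset> C (Suc i)"
    and C: "C k = P"
    by (elim CollectE exE conjE)
  have "k \<le> 1"
  proof (rule ccontr)
    assume "\<not> k \<le> 1"
    then have "k = Suc (Suc (k - 2))" by simp
    then obtain j where k: "k = Suc (Suc j)" by blast
    have "C j \<subset> C (Suc j)" "C (Suc j) \<subset> P" using C'(2) C k by auto
    moreover have "0 \<in> C j" using ideal_0[OF prime_ideal] C'(1) k by simp
    moreover from calculation(1) obtain x where "x \<in> C (Suc j)" "x \<notin> C j" by blast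
    ultimately have "C (Suc j) \<noteq> {0}" "C (Suc j) \<noteq> P" "C (Suc j) \<subseteq> P" by auto
    then show False
      using min[of "C (Suc j)"] C'(1) k by auto
  qed
  then show "h \<le> 1" by (simp add: h one_enat_def)
qed

end

fun nscale :: "nat \<Rightarrow> expvec \<Rightarrow> expvec" where
  "nscale 0 p = 0"
| "nscale (Suc m) p = p + nscale m p"

lemma xt_monom_nscale: "xt_monom (nscale m p) = xt_monom p ^ m"
  by (induction m) (auto simp: xt_monom_0 simp flip: xt_monom_mult)

lemma nscale_add: "nscale (m + l) p = nscale m p + nscale l p"
  by (induction m) (auto simp: add.assoc)

lemma sum_const_nscale: "finite A \<Longrightarrow> (\<Sum>x\<in>A. p) = nscale (card A) p"
  by (induction A rule: finite_induct) auto

section \<open>Primes given by a weight\<close>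

text \<open>The weight plays the role of a linear form supporting a face of the exponent cone.
  Additivity is asked for on the monoid only, since the clique weight is a truncated
  subtraction.\<close>

locale toric_weight = toric +
  fixes v :: "expvec \<Rightarrow> nat"
  assumes v_add: "p \<in> expo \<Gamma> \<Longrightarrow> q \<in> expo \<Gamma> \<Longrightarrow> v (p + q) = v p + v q"
begin

text \<open>The span of the monomials lying off the face v = 0.\<close>

definition val_ideal :: "'a S poly set" where
  "val_ideal = {f \<in> toric_set \<Gamma>. \<forall>p\<in>supp f. v p > 0}"

lemma v_0: "v 0 = 0"
  using v_add[of 0 0] by (simp add: expo.zero)

lemma v_nscale: "p \<in> expo \<Gamma> \<Longrightarrow> nscale m p \<in> expo \<Gamma> \<and> v (nscale m p) = m * v p"
  by (induction m) (auto simp: v_0 v_add expo.zero expo_add)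

lemma xt_monom_val_ideal: "xt_monom p \<in> val_ideal \<longleftrightarrow> p \<in> expo \<Gamma> \<and> v p > 0"
  by (simp add: val_ideal_def supp_xt_monom xt_monom_in_toric_set)

lemma val_ideal: "ideal val_ideal R"
proof (rule toric_idealI)
  show "0 \<in> val_ideal"
    using toric_set_0 by (simp add: val_ideal_def supp_def mcoeff_0)
  show "f + g \<in> val_ideal" if "f \<in> val_ideal" "g \<in> val_ideal" for f g
    using that toric_set_add supp_add[of f g] by (fastforce simp: val_ideal_def)
  show "g * f \<in> val_ideal" if f: "f \<in> val_ideal" and g: "g \<in> toric_set \<Gamma>" for f g
  proof -
    have "v r > 0" if r: "r \<in> supp (g * f)" for r
    proof -
      obtain p q where "p \<in> supp g" "q \<in> supp f" "r = p + q"
        using supp_mult[OF r] .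
      moreover from this have "p \<in> expo \<Gamma>" "q \<in> expo \<Gamma>" "v q > 0"
        using f g by (auto simp: val_ideal_def toric_set_def)
      ultimately show ?thesis by (simp add: v_add)
    qed
    with that show ?thesis by (simp add: val_ideal_def toric_set_mult)
  qed
qed (auto simp: val_ideal_def)

text \<open>Modulo \<open>val_ideal\<close> each element equals its part \<open>low\<close> of
  weight zero. If the product of two elements is in the ideal, then so is the product of their low
  parts, which has terms of weight zero only and therefore vanishes.\<close>

lemma val_ideal_prime: "primeideal val_ideal R"
proof (rule primeidealI[OF val_ideal is_cring])
  have "1 \<notin> val_ideal"
    using xt_monom_val_ideal[of 0] by (simp add: xt_monom_0 v_0)
  then show "carrier R \<noteq> val_ideal"
    using toric_set_1 by auto
next
  define low where "low f = (\<Sum>p\<in>{p \<in> supp f. v p = 0}. scalar (mcoeff f p) * xt_monom p)" for f :: "'a S poly"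
  have cf_low: "mcoeff (low f) p = (if v p = 0 then mcoeff f p else 0)" for f p
    unfolding low_def by (simp add: mcoeff_sum_terms finite_supp) (simp add: supp_def)
  have supp_low: "supp (low f) = {p \<in> supp f. v p = 0}" for f
    by (auto simp: supp_def cf_low)
  have low_toric: "low f \<in> toric_set \<Gamma>" if "f \<in> toric_set \<Gamma>" for f
    using that by (auto simp: toric_set_def supp_low)
  have diff: "f - low f \<in> val_ideal" if "f \<in> toric_set \<Gamma>" for f
  proof -
    have "supp (f - low f) \<subseteq> {p \<in> supp f. v p > 0}"
      using mcoeff_add[of f "- low f"] by (auto simp: supp_def mcoeff_uminus cf_low split: if_splits)
    with that show ?thesis by (auto simp: val_ideal_def toric_set_def)
  qed
  have low_0: "f \<in> val_ideal" if "f \<in> toric_set \<Gamma>" "low f = 0" for f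
    using diff[OF that(1)] that(2) by simp
  fix f g assume f: "f \<in> carrier R" and g: "g \<in> carrier R" and fg: "f \<otimes>\<^bsub>R\<^esub> g \<in> val_ideal"
  have 1: "(f - low f) * g \<in> val_ideal" "low f * (g - low g) \<in> val_ideal"
    using f g diff low_toric by (auto intro: ideal_mult[OF val_ideal] ideal_mult'[OF val_ideal])
  have "low f * low g = f * g + (- ((f - low f) * g) + - (low f * (g - low g)))"
    by (simp add: algebra_simps)
  also have "\<dots> \<in> val_ideal"
    using fg 1 by (intro ideal_add[OF val_ideal] ideal_uminus[OF val_ideal]) simp_all
  finally have *: "v p > 0" if "p \<in> supp (low f * low g)" for p
    using that by (auto simp: val_ideal_def)
  \<comment> \<open>A term of this product would have weight zero by additivity, but positive weight
    as the product lies in \<open>val_ideal\<close>.\<close>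
  have "supp (low f * low g) = {}"
  proof (rule ccontr)
    assume "supp (low f * low g) \<noteq> {}"
    then obtain r where r: "r \<in> supp (low f * low g)" by blast
    then obtain p q where "p \<in> supp (low f)" "q \<in> supp (low g)" "r = p + q"
      by (rule supp_mult)
    moreover from this have "p \<in> expo \<Gamma>" "q \<in> expo \<Gamma>" "v p = 0" "v q = 0"
      using f g by (auto simp: supp_low toric_set_def)
    ultimately show False using *[OF r] by (simp add: v_add)
  qed
  then have "low f = 0 \<or> low g = 0"
    by (simp add: supp_eq_empty)
  then show "f \<in> val_ideal \<or> g \<in> val_ideal"
    using low_0 f g by auto
qed

lemma val_ideal_monomial: "monomial_ideal val_ideal R"
  unfolding monomial_ideal_def
proof (intro exI conjI)
  let ?M = "xt_monom ` {p \<in> expo \<Gamma>. v p > 0} :: 'a S poly set"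
  show M: "?M \<subseteq> carrier R \<inter> monomials"
    by (auto simp: xt_monom_in_toric_set) (auto simp: xt_monom_def monomials_def)
  then have sub: "?M \<subseteq> carrier R" by blast
  show "val_ideal = Idl\<^bsub>R\<^esub> ?M"
  proof
    show "Idl\<^bsub>R\<^esub> ?M \<subseteq> val_ideal"
      by (intro genideal_minimal val_ideal) (auto simp: xt_monom_val_ideal)
    show "val_ideal \<subseteq> Idl\<^bsub>R\<^esub> ?M"
    proof
      fix f assume "f \<in> val_ideal"
      then have f: "f \<in> toric_set \<Gamma>" "\<And>p. p \<in> supp f \<Longrightarrow> xt_monom p \<in> ?M"
        by (auto simp: val_ideal_def toric_set_def)
      show "f \<in> Idl\<^bsub>R\<^esub> ?M"
        by (rule ideal_memberI[OF genideal_ideal[OF sub] f(1)])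
           (rule subsetD[OF genideal_self[OF sub] f(2)])
    qed
  qed
qed

text \<open>After multiplication by monomials of weight zero, a nonzero \<open>f\<close> of a smaller prime becomes a
  power of the uniformizer \<open>y\<close> times an element outside \<open>val_ideal\<close>.  This puts \<open>y\<close>, and hence all of
  \<open>val_ideal\<close>, into the smaller prime.\<close>

lemma val_ideal_height_one:
  assumes y: "y \<in> expo \<Gamma>" "v y = 1"
    and face: "\<And>F. F \<in> \<Gamma> \<Longrightarrow> \<exists>s\<in>expo \<Gamma>. \<exists>t\<in>expo \<Gamma>. v s = 0 \<and> v t = 0 \<and> face_vec F + s = nscale (v (face_vec F)) y + t"
  shows "val_ideal \<in> height_one_monomial_primes R"
proof -
  \<comment> \<open>The relation assumed for the generators extends to the monoid, because relations
    of two summands can be added.\<close>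
  have pure: "\<exists>s\<in>expo \<Gamma>. \<exists>t\<in>expo \<Gamma>. v s = 0 \<and> v t = 0 \<and> p + s = nscale (v p) y + t" if "p \<in> expo \<Gamma>" for p
    using that
  proof induction
    case zero
    show ?case by (rule bexI[of _ 0], rule bexI[of _ 0]) (auto simp: v_0 expo.zero)
  next
    case (step p F)
    obtain s t where st: "s \<in> expo \<Gamma>" "t \<in> expo \<Gamma>" "v s = 0" "v t = 0" "p + s = nscale (v p) y + t"
      using step by blast
    obtain s' t' where st': "s' \<in> expo \<Gamma>" "t' \<in> expo \<Gamma>" "v s' = 0" "v t' = 0"
      "face_vec F + s' = nscale (v (face_vec F)) y + t'"
      using face[OF step(2)] by blast
    have "p + face_vec F + (s + s') = (p + s) + (face_vec F + s')" by (simp add: ac_simps)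
    also have "\<dots> = (nscale (v p) y + t) + (nscale (v (face_vec F)) y + t')"
      by (simp only: st st')
    also have "\<dots> = nscale (v (p + face_vec F)) y + (t + t')"
      by (simp add: v_add[OF step(1) expo_face_vec[OF step(2)]] nscale_add ac_simps)
    finally show ?case
      using st st' by (intro bexI[of _ "s + s'"] bexI[of _ "t + t'"]) (auto simp: v_add expo_add)
  qed
  have y_toric: "xt_monom y ^ m \<in> toric_set \<Gamma>" for m
    using v_nscale[OF y(1)] by (simp add: xt_monom_in_toric_set flip: xt_monom_nscale)
  \<comment> \<open>The terms of \<open>f\<close> are treated one by one; each contributes its own
    weight-zero multiplier, and these accumulate in \<open>s\<close>.\<close>
  have factor: "\<exists>s\<in>expo \<Gamma>. \<exists>u\<in>toric_set \<Gamma>. v s = 0 \<and> f * xt_monom s = xt_monom y ^ m * u"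
    if f: "f \<in> toric_set \<Gamma>" and m: "\<And>p. p \<in> supp f \<Longrightarrow> m \<le> v p" for f :: "'a S poly" and m
  proof -
    have "\<exists>s\<in>expo \<Gamma>. \<exists>u\<in>toric_set \<Gamma>. v s = 0 \<and> (\<Sum>p\<in>J. scalar (mcoeff f p) * xt_monom p) * xt_monom s = xt_monom y ^ m * u"
      if "finite J" "J \<subseteq> supp f" for J
      using that
    proof (induction J rule: finite_induct)
      case empty
      show ?case by (rule bexI[of _ 0], rule bexI[of _ 0]) (auto simp: v_0 expo.zero toric_set_0)
    next
      case (insert p J)
      then obtain s u where su: "s \<in> expo \<Gamma>" "u \<in> toric_set \<Gamma>" "v s = 0"
        "(\<Sum>p\<in>J. scalar (mcoeff f p) * xt_monom p) * xt_monom s = xt_monom y ^ m * u"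
        by (metis (no_types, lifting) insert_subset)
      have p: "p \<in> expo \<Gamma>" "m \<le> v p"
        using insert f m by (auto simp: toric_set_def)
      obtain s' t' where st': "s' \<in> expo \<Gamma>" "t' \<in> expo \<Gamma>" "v s' = 0" "p + s' = nscale (v p) y + t'"
        using pure[OF p(1)] by blast
      \<comment> \<open>What remains of the new term after y^m is split off; the exponent
        \<open>v p - m\<close> does not truncate since \<open>m\<close> bounds all weights of
        \<open>f\<close> from below.\<close>
      define w :: "'a S poly" where "w = scalar (mcoeff f p) * xt_monom y ^ (v p - m) * xt_monom t'"
      have "xt_monom p * xt_monom s' = (xt_monom (nscale (v p) y) * xt_monom t' :: 'a S poly)"
        by (simp only: xt_monom_mult st')
      also have "xt_monom (nscale (v p) y) = (xt_monom y ^ m * xt_monom y ^ (v p - m) :: 'a S poly)"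
        using p(2) by (simp add: xt_monom_nscale flip: power_add)
      finally have "scalar (mcoeff f p) * (xt_monom p * xt_monom s') = xt_monom y ^ m * w"
        unfolding w_def by (simp only: mult_ac)
      then have "(scalar (mcoeff f p) * xt_monom p + (\<Sum>p\<in>J. scalar (mcoeff f p) * xt_monom p)) * (xt_monom s * xt_monom s')
          = xt_monom y ^ m * w * xt_monom s + xt_monom y ^ m * u * xt_monom s'"
        unfolding su(4)[symmetric] by (simp add: algebra_simps)
      then have "(\<Sum>p\<in>insert p J. scalar (mcoeff f p) * xt_monom p) * xt_monom (s + s') = xt_monom y ^ m * (w * xt_monom s + u * xt_monom s')"
        using insert(1,2) by (simp add: xt_monom_mult distrib_left mult.assoc)
      moreover have "w \<in> toric_set \<Gamma>"
        unfolding w_def using y_toric st' by (intro toric_set_mult scalar_in_toric_set) (auto simp: xt_monom_in_toric_set)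
      then have "w * xt_monom s + u * xt_monom s' \<in> toric_set \<Gamma>"
        using su st' by (intro toric_set_add toric_set_mult) (auto simp: xt_monom_in_toric_set)
      ultimately show ?case
        using su(1,3) st'(1,3) by (intro bexI[of _ "s + s'"] bexI[of _ "w * xt_monom s + u * xt_monom s'"]) (auto simp: v_add expo_add)
    qed
    from this[of "supp f"] show ?thesis
      by (simp add: finite_supp flip: sum_terms)
  qed
  have "P' = val_ideal" if P': "primeideal P' R" "P' \<noteq> {0}" "P' \<subseteq> val_ideal" for P'
  proof -
    obtain f where f: "f \<in> P'" "f \<noteq> 0"
      using P' ideal_0[OF prime_ideal] by blast
    have f_toric: "f \<in> toric_set \<Gamma>"
      using f ideal_subset[OF prime_ideal[OF P'(1)]] by blast
    \<comment> \<open>The least weight in \<open>f\<close>, so that nothing of positive weight only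
      is left after division by y^m.\<close>
    define m where "m = Min (v ` supp f)"
    have ne: "finite (v ` supp f)" "v ` supp f \<noteq> {}"
      using f by (auto simp: finite_supp supp_eq_empty)
    obtain p where p: "p \<in> supp f" "v p = m"
      using Min_in[OF ne] by (auto simp: m_def)
    obtain s u where su: "s \<in> expo \<Gamma>" "u \<in> toric_set \<Gamma>" "v s = 0" "f * xt_monom s = xt_monom y ^ m * u"
      using factor[OF f_toric, of m] ne by (auto simp: m_def)
    \<comment> \<open>The product of \<open>f\<close> and the monomial of \<open>s\<close> has a
      term of weight exactly \<open>m\<close>, whereas y^m times an element of
      \<open>val_ideal\<close> has terms of weight above \<open>m\<close> only.\<close>
    have "u \<notin> val_ideal"
    proof
      assume u: "u \<in> val_ideal"
      have "p + s \<in> supp (f * xt_monom s)"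
        using p by (simp add: supp_def mcoeff_mult_xt_monom)
      then have "p + s \<in> supp (xt_monom (nscale m y) * u)"
        unfolding su xt_monom_nscale .
      then obtain r q where q: "r \<in> supp (xt_monom (nscale m y) :: 'a S poly)" "q \<in> supp u" "p + s = r + q"
        by (rule supp_mult)
      then have r: "p + s = nscale m y + q" "v q > 0" "q \<in> expo \<Gamma>"
        using u by (auto simp: supp_xt_monom val_ideal_def toric_set_def)
      moreover have "v (p + s) = m"
        using p su f_toric by (auto simp: v_add toric_set_def)
      ultimately show False
        using v_nscale[OF y(1), of m] y by (simp add: v_add)
    qed
    then have "u \<notin> P'" using P' by blast
    moreover have "xt_monom y ^ m * u \<in> P'"
      using f su ideal_mult[OF prime_ideal[OF P'(1)] f(1), of "xt_monom s"] by (simp add: xt_monom_in_toric_set)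
    ultimately have "xt_monom y ^ m \<in> P'"
      using primeD[OF P'(1)] y_toric su by blast
    then have y_P: "xt_monom y \<in> P'"
      using prime_power[OF P'(1)] y by (simp add: xt_monom_in_toric_set)
    \<comment> \<open>A multiple of the monomial of \<open>q\<close> by one of weight zero is
      divisible by y, hence in \<open>P'\<close>; the weight-zero factor is outside
      \<open>P'\<close>.\<close>
    have mon_P: "xt_monom q \<in> P'" if q: "q \<in> expo \<Gamma>" "v q > 0" for q
    proof -
      obtain s t where st: "s \<in> expo \<Gamma>" "t \<in> expo \<Gamma>" "v s = 0" "q + s = nscale (v q) y + t"
        using pure[OF q(1)] by blast
      obtain l where l: "v q = Suc l" using q not0_implies_Suc by blast
      have "xt_monom q * xt_monom s = (xt_monom y * (xt_monom (nscale l y) * xt_monom t) :: 'a S poly)"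
        by (simp add: xt_monom_mult st l add.assoc)
      also have "\<dots> \<in> P'"
        using y_P st v_nscale[OF y(1)]
        by (intro ideal_mult[OF prime_ideal[OF P'(1)]]) (auto simp: xt_monom_mult xt_monom_in_toric_set expo_add)
      finally have "xt_monom q \<in> P' \<or> xt_monom s \<in> P'"
        using primeD[OF P'(1)] q st by (simp add: xt_monom_in_toric_set)
      moreover have "xt_monom s \<notin> P'"
        using P'(3) st by (auto simp: xt_monom_val_ideal)
      ultimately show ?thesis by blast
    qed
    have "val_ideal \<subseteq> P'"
    proof
      fix g assume "g \<in> val_ideal"
      then have g: "g \<in> toric_set \<Gamma>" "\<And>q. q \<in> supp g \<Longrightarrow> q \<in> expo \<Gamma> \<and> 0 < v q"
        by (auto simp: val_ideal_def toric_set_def)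
      show "g \<in> P'"
        by (rule ideal_memberI[OF prime_ideal[OF P'(1)] g(1)]) (simp add: mon_P g(2))
    qed
    with P' show ?thesis by blast
  qed
  moreover have "val_ideal \<noteq> {0}"
  proof -
    have "xt_monom y \<in> val_ideal" using y by (simp add: xt_monom_val_ideal)
    moreover have "xt_monom y \<noteq> (0 :: 'a S poly)" using supp_xt_monom[of y] supp_eq_empty[of "xt_monom y"] by auto
    ultimately show ?thesis by blast
  qed
  ultimately show ?thesis
    unfolding height_one_monomial_primes_def
    by (simp add: val_ideal_prime val_ideal_monomial prime_height_oneI)
qed

end

section \<open>Calculus of exponents modulo those of weight zero\<close>

lemma nscale_distrib: "nscale m (p + q) = nscale m p + nscale m q"
  by (induction m) (auto simp: ac_simps)

lemma nscale_0: "nscale m 0 = 0"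
  by (induction m) auto

context toric_weight
begin

text \<open>Equality modulo the group generated by the exponents of weight zero.\<close>

definition eqv :: "expvec \<Rightarrow> expvec \<Rightarrow> bool" where
  "eqv p q \<longleftrightarrow> (\<exists>s\<in>expo \<Gamma>. \<exists>t\<in>expo \<Gamma>. v s = 0 \<and> v t = 0 \<and> p + s = q + t)"

lemma eqvI: "\<lbrakk>s \<in> expo \<Gamma>; t \<in> expo \<Gamma>; v s = 0; v t = 0; p + s = q + t\<rbrakk> \<Longrightarrow> eqv p q"
  unfolding eqv_def by blast

lemma eqvE:
  assumes "eqv p q"
  obtains s t where "s \<in> expo \<Gamma>" "t \<in> expo \<Gamma>" "v s = 0" "v t = 0" "p + s = q + t"
  using assms unfolding eqv_def by blast

lemma eqv_refl: "eqv p p"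
  by (rule eqvI[of 0 0]) (simp_all add: expo.zero v_0)

lemma eqv_sym: "eqv p q \<Longrightarrow> eqv q p"
  unfolding eqv_def by metis

lemma eqv_trans [trans]:
  assumes "eqv p q" "eqv q r"
  shows "eqv p r"
proof -
  obtain s t where st: "s \<in> expo \<Gamma>" "t \<in> expo \<Gamma>" "v s = 0" "v t = 0" "p + s = q + t"
    using assms(1) by (rule eqvE)
  obtain s' t' where st': "s' \<in> expo \<Gamma>" "t' \<in> expo \<Gamma>" "v s' = 0" "v t' = 0" "q + s' = r + t'"
    using assms(2) by (rule eqvE)
  have "p + (s + s') = (q + t) + s'" by (simp add: st(5)[symmetric] add.assoc)
  also have "\<dots> = (q + s') + t" by (simp add: ac_simps)
  also have "\<dots> = r + (t' + t)" by (simp add: st' add.assoc)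
  finally show ?thesis
    using st st' by (intro eqvI[of "s + s'" "t' + t"]) (simp_all add: expo_add v_add)
qed

lemma eqv_add:
  assumes "eqv p q" "eqv p' q'"
  shows "eqv (p + p') (q + q')"
proof -
  obtain s t where st: "s \<in> expo \<Gamma>" "t \<in> expo \<Gamma>" "v s = 0" "v t = 0" "p + s = q + t"
    using assms(1) by (rule eqvE)
  obtain s' t' where st': "s' \<in> expo \<Gamma>" "t' \<in> expo \<Gamma>" "v s' = 0" "v t' = 0" "p' + s' = q' + t'"
    using assms(2) by (rule eqvE)
  have "(p + p') + (s + s') = (p + s) + (p' + s')" by (simp add: ac_simps)
  also have "\<dots> = (q + q') + (t + t')" by (simp only: st st') (simp add: ac_simps)
  finally show ?thesis
    using st st' by (intro eqvI[of "s + s'" "t + t'"]) (simp_all add: expo_add v_add)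
qed

lemma eqv_cancel:
  assumes "eqv (p + c) (q + c)"
  shows "eqv p q"
proof -
  obtain s t where st: "s \<in> expo \<Gamma>" "t \<in> expo \<Gamma>" "v s = 0" "v t = 0" "(p + c) + s = (q + c) + t"
    using assms by (rule eqvE)
  then have "(p + s) + c = (q + t) + c" by (simp only: ac_simps)
  then have "p + s = q + t" by (rule add_right_imp_eq)
  with st show ?thesis by (intro eqvI)
qed

lemma eqv_0: "p \<in> expo \<Gamma> \<Longrightarrow> v p = 0 \<Longrightarrow> eqv p 0"
  by (rule eqvI[of 0 p]) (simp_all add: expo.zero v_0)

lemma eqv_sum: "(\<And>x. x \<in> A \<Longrightarrow> eqv (f x) (g x)) \<Longrightarrow> eqv (sum f A) (sum g A)"
  by (induction A rule: infinite_finite_induct) (simp_all add: eqv_refl eqv_add)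

lemma eqv_nscale: "eqv p q \<Longrightarrow> eqv (nscale m p) (nscale m q)"
  by (induction m) (simp_all add: eqv_refl eqv_add)

lemma val_ideal_height_one_eqv:
  assumes "y \<in> expo \<Gamma>" "v y = 1" "\<And>F. F \<in> \<Gamma> \<Longrightarrow> eqv (face_vec F) (nscale (v (face_vec F)) y)"
  shows "val_ideal \<in> height_one_monomial_primes R"
  using val_ideal_height_one[OF assms(1,2)] assms(3) unfolding eqv_def by blast

end

text \<open>The exponent of x_i, a monomial of degree 0 in t and thus outside the toric ring;
  congruences between such vectors still make sense, since \<open>eqv\<close> relates arbitrary
  exponent vectors.\<close>

definition unit_vec :: "nat \<Rightarrow> expvec" where
  "unit_vec i = (Poly_Mapping.single i 1, 0)"

lemma face_vec_eq_sum: "face_vec F = sum unit_vec F + face_vec {}"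
  by (simp add: face_vec_def unit_vec_def prod_eq_iff fst_sum snd_sum)

lemma face_vec_insert: "finite F \<Longrightarrow> i \<notin> F \<Longrightarrow> face_vec (insert i F) = unit_vec i + face_vec F"
  by (simp add: face_vec_def unit_vec_def)

lemma snd_face_vec: "snd (face_vec F) = 1"
  by (simp add: face_vec_def)

lemma lookup_face_vec: "finite F \<Longrightarrow> Poly_Mapping.lookup (fst (face_vec F)) i = (if i \<in> F then 1 else 0)"
  by (simp add: face_vec_def lookup_sum lookup_single when_def)

definition coord_sum :: "nat set \<Rightarrow> expvec \<Rightarrow> nat" where
  "coord_sum B p = (\<Sum>b\<in>B. Poly_Mapping.lookup (fst p) b)"

lemma coord_sum_add: "coord_sum B (p + q) = coord_sum B p + coord_sum B q"
  by (simp add: coord_sum_def lookup_add sum.distrib)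

lemma coord_sum_face_vec: "finite B \<Longrightarrow> finite F \<Longrightarrow> coord_sum B (face_vec F) = card (F \<inter> B)"
  by (simp add: coord_sum_def lookup_face_vec sum.If_cases Int_commute)

section \<open>Height one monomial primes of a complex\<close>

locale toric_complex = toric +
  assumes finite_complex: "finite \<Gamma>"
    and empty_face: "{} \<in> \<Gamma>"
    and face_subset: "F \<in> \<Gamma> \<Longrightarrow> G \<subseteq> F \<Longrightarrow> G \<in> \<Gamma>"
begin

text \<open>The uniformizer is x_i t. A face without i has weight zero, and a face with i is
  congruent to the uniformizer.\<close>

lemma coordinate_prime_height_one:
  assumes i: "{i} \<in> \<Gamma>"
  shows "{f \<in> toric_set \<Gamma>. \<forall>p\<in>supp f. Poly_Mapping.lookup (fst p) i > 0} \<in> height_one_monomial_primes R"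
proof -
  interpret toric_weight \<Gamma> R "\<lambda>p. Poly_Mapping.lookup (fst p) i"
    by unfold_locales (simp add: lookup_add)
  have "val_ideal \<in> height_one_monomial_primes R"
  proof (rule val_ideal_height_one_eqv)
    show "face_vec {i} \<in> expo \<Gamma>" using i by (rule expo_face_vec)
    show "Poly_Mapping.lookup (fst (face_vec {i})) i = 1" by (simp add: lookup_face_vec)
    fix F assume F: "F \<in> \<Gamma>"
    then have fin: "finite F" by (rule finite_face)
    show "eqv (face_vec F) (nscale (Poly_Mapping.lookup (fst (face_vec F)) i) (face_vec {i}))"
    proof (cases "i \<in> F")
      case False
      then show ?thesis
        using F fin by (simp add: lookup_face_vec) (intro eqv_0 expo_face_vec, simp_all add: lookup_face_vec)
    next
      case True
      have "face_vec F = unit_vec i + face_vec (F - {i})"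
        using face_vec_insert[of "F - {i}" i] fin True by (simp add: insert_absorb)
      \<comment> \<open>The relation x_F t * t = x_i t * x_{F - i} t, where t and x_{F - i} t have
        weight zero.\<close>
      then have "face_vec F + face_vec {} = face_vec {i} + face_vec (F - {i})"
        by (simp add: face_vec_insert ac_simps)
      then have "eqv (face_vec F) (face_vec {i})"
        using fin F face_subset[OF F, of "F - {i}"]
        by (intro eqvI[of "face_vec {}" "face_vec (F - {i})"]) (simp_all add: expo_face_vec empty_face lookup_face_vec Diff_subset)
      with True fin show ?thesis by (simp add: lookup_face_vec)
    qed
  qed
  then show ?thesis by (simp add: val_ideal_def)
qed

text \<open>Let e_i be the exponent of x_i and e that of t. Modulo weight zero, e_i vanishes for
  vertices i outside \<open>B\<close>, and all e_c with c in \<open>B\<close> agree with one e_b,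
  where (d - 1) e_b + e is congruent to 0. So every face is congruent to a multiple of the class of
  -e_b, which is represented by a face of d - 2 elements of \<open>B\<close>.\<close>

lemma clique_prime_height_one:
  assumes B: "finite B" "d \<le> card B" and d: "2 \<le> d"
    and face_B: "\<And>F. F \<in> \<Gamma> \<Longrightarrow> card (F \<inter> B) \<le> d - 1"
    and small: "\<And>T. T \<subseteq> B \<Longrightarrow> card T \<le> d - 1 \<Longrightarrow> T \<in> \<Gamma>"
    and extend: "\<And>i. {i} \<in> \<Gamma> \<Longrightarrow> i \<notin> B \<Longrightarrow> \<exists>T\<subseteq>B. card T = d - 1 \<and> insert i T \<in> \<Gamma>"
  shows "{f \<in> toric_set \<Gamma>. \<forall>p\<in>supp f. coord_sum B p < snd p * (d - 1)} \<in> height_one_monomial_primes R"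
proof -
  \<comment> \<open>The subtraction never truncates on exponents of the toric ring, by \<open>le\<close>.\<close>
  define v where "v p = snd p * (d - 1) - coord_sum B p" for p
  have le: "coord_sum B p \<le> snd p * (d - 1)" if "p \<in> expo \<Gamma>" for p
    using that
  proof induction
    case (step p F)
    then have "coord_sum B (face_vec F) \<le> d - 1"
      using face_B B finite_face by (simp add: coord_sum_face_vec)
    with step show ?case by (simp add: coord_sum_add snd_face_vec)
  qed (simp add: coord_sum_def)
  interpret toric_weight \<Gamma> R v
  proof
    show "v (p + q) = v p + v q" if "p \<in> expo \<Gamma>" "q \<in> expo \<Gamma>" for p q
      using le[OF that(1)] le[OF that(2)] by (simp add: v_def coord_sum_add algebra_simps)
  qed
  have v_face_vec: "v (face_vec F) = d - 1 - card (F \<inter> B)" if "F \<in> \<Gamma>" for F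
    using that B finite_face by (simp add: v_def coord_sum_face_vec snd_face_vec)
  have facial: "eqv (face_vec F) 0" if "F \<in> \<Gamma>" "card (F \<inter> B) = d - 1" for F
    using that by (intro eqv_0 expo_face_vec) (simp_all add: v_face_vec)
  have full: "eqv (face_vec T) 0" if "T \<subseteq> B" "card T = d - 1" for T
    using that small by (intro facial) (simp_all add: Int_absorb2)
  \<comment> \<open>Both \<open>T\<close> and \<open>insert i T\<close> meet \<open>B\<close> in d -
    1 elements, so both have weight zero, and they differ by e_i.\<close>
  have outside: "eqv (unit_vec i) 0" if i: "{i} \<in> \<Gamma>" "i \<notin> B" for i
  proof -
    obtain T where T: "T \<subseteq> B" "card T = d - 1" "insert i T \<in> \<Gamma>"
      using extend[OF i] by blast
    have fin: "finite T" "i \<notin> T" using T B i finite_subset by auto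
    have "eqv (face_vec (insert i T)) 0"
      using T i by (intro facial) (simp_all add: Int_absorb2)
    then have "eqv (unit_vec i + face_vec T) 0"
      using fin by (simp add: face_vec_insert)
    also have "eqv 0 (0 + face_vec T)"
      using full[OF T(1,2)] by (simp add: eqv_sym)
    finally show ?thesis by (rule eqv_cancel)
  qed
  have "B \<noteq> {}" using B d by auto
  then obtain b where b: "b \<in> B" by blast
  have inside: "eqv (unit_vec c) (unit_vec b)" if c: "c \<in> B" for c
  proof (cases "c = b")
    case False
    \<comment> \<open>Since \<open>B\<close> has at least d elements, d - 2 of them remain; adding b
      or c to them gives two (d - 1)-subsets of \<open>B\<close>, and comparing these identifies e_b
      with e_c.\<close>
    have "d - 2 \<le> card (B - {b, c})"
      using B b c False by (simp add: card_Diff_subset)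
    then obtain U where U: "U \<subseteq> B - {b, c}" "card U = d - 2" "finite U"
      by (rule obtain_subset_with_card_n)
    have *: "eqv (unit_vec x + face_vec U) 0" if "x \<in> {b, c}" for x
    proof -
      have "x \<notin> U" using that U by blast
      moreover have "eqv (face_vec (insert x U)) 0"
        using that U b c d \<open>x \<notin> U\<close> by (intro full) auto
      ultimately show ?thesis using U by (simp add: face_vec_insert)
    qed
    have "eqv (unit_vec c + face_vec U) 0" by (rule *) simp
    also have "eqv 0 (unit_vec b + face_vec U)" by (rule eqv_sym, rule *) simp
    finally show ?thesis by (rule eqv_cancel)
  qed (simp add: eqv_refl)
  have normal: "eqv (face_vec F) (nscale (card (F \<inter> B)) (unit_vec b) + face_vec {})" if F: "F \<in> \<Gamma>" for F
  proof -
    have fin: "finite F" using F by (rule finite_face)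
    have "eqv (sum unit_vec F) (\<Sum>i\<in>F. if i \<in> B then unit_vec b else 0)"
      using face_subset[OF F] by (intro eqv_sum) (simp add: inside outside)
    also have "(\<Sum>i\<in>F. if i \<in> B then unit_vec b else 0) = nscale (card (F \<inter> B)) (unit_vec b)"
      using fin by (simp add: sum.If_cases sum_const_nscale Int_def)
    finally show ?thesis
      by (subst face_vec_eq_sum) (intro eqv_add eqv_refl)
  qed
  \<comment> \<open>The uniformizer comes from d - 2 elements \<open>U\<close> of \<open>B\<close>,
    with weight (d - 1) - (d - 2) = 1.\<close>
  have "d - 2 \<le> card (B - {b})"
    using B b by simp
  then obtain U where U: "U \<subseteq> B - {b}" "card U = d - 2" "finite U"
    by (rule obtain_subset_with_card_n)
  have bU: "b \<notin> U" "insert b U \<subseteq> B" "U \<subseteq> B"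
    using U b by auto
  then have card_bU: "card (insert b U) = d - 1"
    using U d by simp
  have U_face: "U \<in> \<Gamma>" "insert b U \<in> \<Gamma>"
    using bU card_bU U small by simp_all
  have y: "eqv (unit_vec b + face_vec U) 0"
    using full[OF bU(2) card_bU] U bU by (simp add: face_vec_insert)
  have top: "eqv (nscale (d - 1) (unit_vec b) + face_vec {}) 0"
    using eqv_trans[OF eqv_sym[OF normal[OF U_face(2)]] full[OF bU(2) card_bU]] bU card_bU by (simp add: Int_absorb2)
  have "val_ideal \<in> height_one_monomial_primes R"
  proof (rule val_ideal_height_one_eqv)
    show "face_vec U \<in> expo \<Gamma>" using U_face(1) by (rule expo_face_vec)
    show "v (face_vec U) = 1" using U_face bU U d by (simp add: v_face_vec Int_absorb2)
    fix F assume F: "F \<in> \<Gamma>"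
    define w where "w = v (face_vec F)"
    have w: "w + card (F \<inter> B) = d - 1"
      using face_B[OF F] by (simp add: w_def v_face_vec F)
    \<comment> \<open>Subtraction of e_b is avoided: w copies of it are added to both sides, both
      become congruent to 0, and the copies are cancelled.\<close>
    have "eqv (face_vec F + nscale w (unit_vec b)) (nscale (card (F \<inter> B)) (unit_vec b) + face_vec {} + nscale w (unit_vec b))"
      by (intro eqv_add normal F eqv_refl)
    also have "\<dots> = nscale (d - 1) (unit_vec b) + face_vec {}"
      by (simp only: w[symmetric] nscale_add ac_simps)
    also have "eqv \<dots> 0" by (rule top)
    also have "eqv 0 (nscale w (unit_vec b + face_vec U))"
      using eqv_nscale[OF y, of w] by (simp add: nscale_0 eqv_sym)
    also have "nscale w (unit_vec b + face_vec U) = nscale w (face_vec U) + nscale w (unit_vec b)"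
      by (simp add: nscale_distrib add.commute)
    finally show "eqv (face_vec F) (nscale (v (face_vec F)) (face_vec U))"
      unfolding w_def by (rule eqv_cancel)
  qed
  then show ?thesis by (simp add: val_ideal_def v_def)
qed

section \<open>Monomials contained in height one monomial primes\<close>

lemma monomial_prime_contains_generator:
  assumes P: "P \<in> height_one_monomial_primes R"
  shows "\<exists>F\<in>\<Gamma>. xt_monom (face_vec F) \<in> P"
proof -
  have prime: "primeideal P R" and nonzero: "P \<noteq> {0}"
    using P prime_height_pos_nonzero by (auto simp: height_one_monomial_primes_def)
  obtain M where M: "M \<subseteq> carrier R \<inter> monomials" "P = Idl\<^bsub>R\<^esub> M"
    using P by (auto simp: height_one_monomial_primes_def monomial_ideal_def)
  \<comment> \<open>The empty set generates {0}, which does not have height one.\<close>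
  have "M \<noteq> {}"
  proof
    assume "M = {}"
    then have "P \<subseteq> {0}"
      unfolding M by (intro genideal_minimal prime_ideal[OF zero_prime]) simp
    with nonzero ideal_0[OF prime_ideal[OF prime]] show False by blast
  qed
  then obtain m where m: "m \<in> M" by blast
  then obtain p where p: "m = xt_monom p"
    using M(1) by (auto simp: monomials_def xt_monom_def)
  have "p \<in> expo \<Gamma>" "xt_monom p \<in> P"
    using m M genideal_self[of M] xt_monom_in_toric_set[of p \<Gamma>] by (auto simp: p)
  \<comment> \<open>A prime containing a product of generators contains one of them.\<close>
  then show ?thesis
  proof induction
    case zero
    then show ?case using prime_1[OF prime] by (simp add: xt_monom_0)
  next
    case (step p F)
    then have "xt_monom p * xt_monom (face_vec F) \<in> P" by (simp add: xt_monom_mult)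
    then have "xt_monom p \<in> P \<or> xt_monom (face_vec F) \<in> P"
      using step by (intro primeD[OF prime]) (simp_all add: xt_monom_in_toric_set expo_face_vec)
    with step show ?case by blast
  qed
qed

lemma xt_monom_sum_in_ideal:
  assumes "ideal I R" "finite A" "a \<in> A" "xt_monom (f a) \<in> I" "\<And>x. x \<in> A \<Longrightarrow> f x \<in> expo \<Gamma>"
  shows "xt_monom (sum f A) \<in> I"
proof -
  have "xt_monom (sum f A) = xt_monom (f a) * xt_monom (sum f (A - {a}))"
    using assms by (simp add: xt_monom_mult sum.remove)
  also have "\<dots> \<in> I"
    using assms by (intro ideal_mult) (auto simp: xt_monom_in_toric_set intro: expo_sum)
  finally show ?thesis .
qed

text \<open>The product of all generators lies in each height one monomial prime, as each contains
  some generator. Hence the minimum defining the a-invariant is attained.\<close>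

lemma canonical_ideal_nonzero: "xt_monom (sum face_vec \<Gamma>) \<in> canonical_ideal R"
  unfolding canonical_ideal_def
proof (intro IntI InterI)
  show "xt_monom (sum face_vec \<Gamma>) \<in> carrier R"
    by (simp add: xt_monom_in_toric_set expo_sum expo_face_vec)
  fix P assume P: "P \<in> height_one_monomial_primes R"
  then obtain F where "F \<in> \<Gamma>" "xt_monom (face_vec F) \<in> P"
    using monomial_prime_contains_generator by blast
  then show "xt_monom (sum face_vec \<Gamma>) \<in> P"
    using P by (intro xt_monom_sum_in_ideal[OF prime_ideal] finite_complex)
      (simp_all add: height_one_monomial_primes_def expo_face_vec)
qed

lemma prime_without_tvar:
  assumes P: "P \<in> height_one_monomial_primes R" and t: "tvar \<notin> P"
  shows "\<exists>i. {i} \<in> \<Gamma> \<and> (\<forall>F\<in>\<Gamma>. i \<in> F \<longrightarrow> xt_monom (face_vec F) \<in> P)"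
proof -
  have prime: "primeideal P R" using P by (simp add: height_one_monomial_primes_def)
  note id = prime_ideal[OF prime]
  have split: "xt_monom (face_vec F) * xt_monom (face_vec {}) = (xt_monom (face_vec {i}) * xt_monom (face_vec (F - {i})) :: 'a S poly)"
    if "finite F" "i \<in> F" for F i
  proof -
    have "face_vec F = unit_vec i + face_vec (F - {i})"
      using face_vec_insert[of "F - {i}" i] that by (simp add: insert_absorb)
    then show ?thesis by (simp add: xt_monom_mult face_vec_insert ac_simps)
  qed
  obtain F where "F \<in> \<Gamma>" "xt_monom (face_vec F) \<in> P"
    using monomial_prime_contains_generator[OF P] by blast
  then have "finite F" "F \<in> \<Gamma>" "xt_monom (face_vec F) \<in> P" using finite_face by auto
  \<comment> \<open>Vertices are split off one at a time by means of \<open>split\<close>; the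
    process cannot end at the empty face, whose monomial is t.\<close>
  then have "\<exists>i\<in>F. xt_monom (face_vec {i}) \<in> P"
  proof (induction F rule: finite_induct)
    case empty
    then show ?case using t by (simp add: tvar_eq)
  next
    case (insert i F)
    have faces: "{i} \<in> \<Gamma>" "F \<in> \<Gamma>" using insert face_subset by blast+
    have "xt_monom (face_vec (insert i F)) * xt_monom (face_vec {}) \<in> P"
      using insert by (intro ideal_mult[OF id]) (simp_all add: xt_monom_in_toric_set expo_face_vec empty_face)
    then have "xt_monom (face_vec {i}) * xt_monom (face_vec F) \<in> P"
      using split[of "insert i F" i] insert by simp
    then have "xt_monom (face_vec {i}) \<in> P \<or> xt_monom (face_vec F) \<in> P"
      using faces by (intro primeD[OF prime]) (simp_all add: xt_monom_in_toric_set expo_face_vec)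
    with insert faces show ?case by blast
  qed
  then obtain i where i: "i \<in> F" "xt_monom (face_vec {i}) \<in> P" by blast
  \<comment> \<open>The same relation read backwards: x_G t * t is a multiple of x_i t, and t is
    outside \<open>P\<close>.\<close>
  have "xt_monom (face_vec G) \<in> P" if G: "G \<in> \<Gamma>" "i \<in> G" for G
  proof -
    have "xt_monom (face_vec G) * xt_monom (face_vec {}) \<in> P"
      unfolding split[OF finite_face[OF G(1)] G(2)]
      using i face_subset[OF G(1), of "G - {i}"]
      by (intro ideal_mult[OF id]) (auto simp: xt_monom_in_toric_set expo_face_vec)
    then have "xt_monom (face_vec G) \<in> P \<or> xt_monom (face_vec {}) \<in> P"
      using G by (intro primeD[OF prime]) (simp_all add: xt_monom_in_toric_set expo_face_vec empty_face)
    with t show ?thesis by (simp add: tvar_eq)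
  qed
  moreover have "{i} \<in> \<Gamma>" using i \<open>F \<in> \<Gamma>\<close> face_subset by blast
  ultimately show ?thesis by blast
qed

end

section \<open>Unit-interval complexes\<close>

locale unit_interval =
  fixes n d :: nat and \<Delta> :: "nat set set"
  assumes unit_interval: "unit_interval_complex n \<Delta>"
    and dim: "complex_dim \<Delta> = int d - 1"
    and d_ge: "3 \<le> d"
begin

lemma faces_subset: "F \<in> \<Delta> \<Longrightarrow> F \<subseteq> {1..n}"
  using unit_interval by (auto simp: unit_interval_complex_def simplicial_complex_on_def)

lemma finite_\<Delta>: "finite \<Delta>"
  using faces_subset by (intro finite_subset[of \<Delta> "Pow {1..n}"]) auto

lemma ex_facet: "\<exists>F\<in>facets \<Delta>. card F = d"
proof -
  have "\<Delta> \<noteq> {}"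
    using unit_interval by (simp add: unit_interval_complex_def simplicial_complex_on_def)
  then have "Max (card ` \<Delta>) \<in> card ` \<Delta>"
    using finite_\<Delta> by (intro Max_in) auto
  moreover have max: "Max (card ` \<Delta>) = d"
    using dim by (simp add: complex_dim_def)
  ultimately obtain F where F: "F \<in> \<Delta>" "card F = d" by auto
  have "F = G" if "G \<in> \<Delta>" "F \<subseteq> G" for G
  proof -
    have "card G \<le> card F"
      using Max_ge[of "card ` \<Delta>" "card G"] that finite_\<Delta> F max by simp
    then show ?thesis
      using that faces_subset[OF that(1)] by (intro card_seteq) (auto intro: finite_subset)
  qed
  with F show ?thesis by (auto simp: facets_def)
qed

lemma card_facet:
  assumes "F \<in> facets \<Delta>"
  shows "card F = d"
proof -
  obtain G where G: "G \<in> facets \<Delta>" "card G = d"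
    using ex_facet by blast
  have "pure_complex \<Delta>"
    using unit_interval by (simp add: unit_interval_complex_def)
  then show ?thesis
    using assms G unfolding pure_complex_def by metis
qed

lemma facet_subset: "F \<in> facets \<Delta> \<Longrightarrow> F \<subseteq> {1..n}"
  using faces_subset by (simp add: facets_def)

lemma interval_clique: "F \<in> facets \<Delta> \<Longrightarrow> {Min F..Max F} \<in> cliques n d \<Delta>"
  using unit_interval card_facet[of F] unfolding unit_interval_complex_def by metis

lemma finite_cliques: "finite (cliques n d \<Delta>)"
  by (rule finite_subset[of _ "Pow {1..n}"]) (auto simp: cliques_def)

lemma clique_subset: "C \<in> cliques n d \<Delta> \<Longrightarrow> C \<subseteq> {1..n}"
  by (simp add: cliques_def)

lemma finite_clique: "C \<in> cliques n d \<Delta> \<Longrightarrow> finite C"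
  using clique_subset finite_subset by blast

lemma card_clique_le: "C \<in> cliques n d \<Delta> \<Longrightarrow> card C \<le> clique_number n d \<Delta>"
  unfolding clique_number_def using finite_cliques by (intro Max_ge) auto

lemma facet_clique: "F \<in> facets \<Delta> \<Longrightarrow> F \<in> cliques n d \<Delta>"
proof -
  assume F: "F \<in> facets \<Delta>"
  have "G = F" if "G \<subseteq> F" "card G = d" for G
    using that card_facet[OF F] facet_subset[OF F] finite_subset by (intro card_subset_eq) auto
  with F facet_subset[OF F] show ?thesis by (auto simp: cliques_def)
qed

lemma clique_number_ge: "d \<le> clique_number n d \<Delta>"
  using ex_facet facet_clique card_clique_le card_facet by metis

text \<open>A clique of largest size is inclusion-maximal, and it meets the size bound because a
  facet is already a clique with d elements.\<close>

lemma ex_maximal_clique: "\<exists>B\<in>maximal_cliques n d \<Delta>. card B = clique_number n d \<Delta>"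
proof -
  have "cliques n d \<Delta> \<noteq> {}" using ex_facet facet_clique by blast
  then have "clique_number n d \<Delta> \<in> card ` cliques n d \<Delta>"
    unfolding clique_number_def using finite_cliques by (intro Max_in) auto
  then obtain B where B: "B \<in> cliques n d \<Delta>" "card B = clique_number n d \<Delta>" by auto
  have "B = C" if "C \<in> cliques n d \<Delta>" "B \<subseteq> C" for C
    using that B card_clique_le[OF that(1)] finite_clique by (intro card_seteq) auto
  with B clique_number_ge show ?thesis
    by (intro bexI[of _ B]) (auto simp: maximal_cliques_def)
qed

lemma Ind_toric_complex: "toric_complex (Ind n \<Delta>) (toric_ring (Ind n \<Delta>))"
proof
  show "finite F" if "F \<in> Ind n \<Delta>" for F
    using that by (auto simp: Ind_def intro: finite_subset)
  show "finite (Ind n \<Delta>)"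
    by (rule finite_subset[of _ "Pow {1..n}"]) (auto simp: Ind_def)
  show "{} \<in> Ind n \<Delta>"
    using card_facet d_ge by (fastforce simp: Ind_def)
  show "G \<in> Ind n \<Delta>" if "F \<in> Ind n \<Delta>" "G \<subseteq> F" for F G
    using that unfolding Ind_def by blast
qed simp

lemma small_Ind:
  assumes "T \<subseteq> {1..n}" "card T \<le> d - 1"
  shows "T \<in> Ind n \<Delta>"
proof -
  have "\<not> F \<subseteq> T" if "F \<in> facets \<Delta>" for F
    using card_mono[of T F] card_facet[OF that] assms d_ge finite_subset[OF assms(1)] by auto
  with assms show ?thesis by (auto simp: Ind_def)
qed

lemma Ind_inter_clique:
  assumes "F \<in> Ind n \<Delta>" "B \<in> cliques n d \<Delta>"
  shows "card (F \<inter> B) \<le> d - 1"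
proof (rule ccontr)
  assume "\<not> card (F \<inter> B) \<le> d - 1"
  then have "d \<le> card (F \<inter> B)" by simp
  then obtain G where "G \<subseteq> F \<inter> B" "card G = d"
    by (rule obtain_subset_with_card_n)
  with assms show False by (auto simp: Ind_def cliques_def)
qed

text \<open>Supplies the hypothesis \<open>extend\<close> of \<open>clique_prime_height_one\<close>,
  which makes e_i vanish modulo weight zero for i outside \<open>B\<close>.\<close>

lemma extend_maximal_clique:
  assumes B: "B \<in> maximal_cliques n d \<Delta>" and i: "i \<in> {1..n}" "i \<notin> B"
  shows "\<exists>T\<subseteq>B. card T = d - 1 \<and> insert i T \<in> Ind n \<Delta>"
proof -
  have B': "B \<in> cliques n d \<Delta>" "d \<le> card B" "\<And>C. C \<in> cliques n d \<Delta> \<Longrightarrow> B \<subseteq> C \<Longrightarrow> B = C"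
    using B by (auto simp: maximal_cliques_def)
  have fin: "finite B" and ne: "B \<noteq> {}" using finite_clique[OF B'(1)] B'(2) d_ge by auto
  \<comment> \<open>If \<open>T\<close> contains both ends of \<open>B\<close> and \<open>T \<union> {i}\<close> were a facet, the interval it spans would be a
    clique strictly larger than \<open>B\<close>.\<close>
  have ends: "{Min B, Max B} \<subseteq> B" using fin ne by simp
  \<comment> \<open>Both ends fit into a set of d - 1 elements because d is at least 3.\<close>
  have "card {Min B, Max B} \<le> d - 1"
    using d_ge by (cases "Min B = Max B") auto
  moreover have "d - 1 \<le> card B" using B'(2) by simp
  ultimately obtain T where T: "{Min B, Max B} \<subseteq> T" "T \<subseteq> B" "card T = d - 1"
    using exists_subset_between[OF _ _ ends fin] by blast
  have "insert i T \<in> Ind n \<Delta>"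
  proof (rule ccontr)
    assume "insert i T \<notin> Ind n \<Delta>"
    moreover have sub: "insert i T \<subseteq> {1..n}" using T i clique_subset[OF B'(1)] by auto
    ultimately obtain F where F: "F \<in> facets \<Delta>" "F \<subseteq> insert i T"
      by (auto simp: Ind_def)
    have fT: "finite (insert i T)" using sub by (rule finite_subset) simp
    have "i \<notin> T" using T(2) i(2) by blast
    then have "card (insert i T) = d" using T(3) fT d_ge by simp
    then have FT: "F = insert i T"
      using F fT card_facet[OF F(1)] by (intro card_subset_eq) auto
    have bounds: "Min F \<le> x \<and> x \<le> Max F" if "x \<in> insert i B" for x
    proof -
      have fF: "finite F" using fT FT by simp
      have m: "Min F \<le> Min B" "Max B \<le> Max F" "Min F \<le> i" "i \<le> Max F"
        using T fF by (auto simp: FT)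
      have "x = i \<or> Min B \<le> x \<and> x \<le> Max B"
        using that fin by auto
      with m show ?thesis by linarith
    qed
    then have "B \<subseteq> {Min F..Max F}" "i \<in> {Min F..Max F}" by auto
    with B'(3)[OF interval_clique[OF F(1)]] i show False by blast
  qed
  with T show ?thesis by blast
qed

text \<open>Distinct members of a residue class have distinct quotients by \<open>q\<close>, so d of
  them spread over a distance of at least q(d - 1). A facet inside the class would span a clique
  that is too large.\<close>

lemma residue_class_Ind:
  assumes q: "clique_number n d \<Delta> < q * (d - 1)"
  shows "{i \<in> {1..n}. i mod q = r} \<in> Ind n \<Delta>"
proof -
  have False if F: "F \<in> facets \<Delta>" "F \<subseteq> {i \<in> {1..n}. i mod q = r}" for F
  proof -
    have fin: "finite F" using F(2) by (rule finite_subset) simp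
    have ne: "F \<noteq> {}" using card_facet[OF F(1)] d_ge by auto
    have r: "x mod q = r" if "x \<in> F" for x using that F by auto
    have "inj_on (\<lambda>x. x div q) F"
      by (rule inj_onI) (metis r div_mult_mod_eq)
    then have "d = card ((\<lambda>x. x div q) ` F)"
      using card_facet[OF F(1)] by (simp add: card_image)
    also have "\<dots> \<le> card {Min F div q..Max F div q}"
      using fin by (intro card_mono) (auto simp: div_le_mono)
    finally have "d - 1 \<le> Max F div q - Min F div q" by simp
    then have "q * (d - 1) \<le> q * (Max F div q - Min F div q)" by simp
    \<comment> \<open>Both ends leave the same remainder \<open>r\<close>, so the distance is an
      exact multiple of \<open>q\<close>.\<close>
    also have "\<dots> = Max F - Min F"
    proof -
      have "Max F = q * (Max F div q) + r" "Min F = q * (Min F div q) + r"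
        using r[OF Max_in[OF fin ne]] r[OF Min_in[OF fin ne]] by (metis mult_div_mod_eq)+
      then show ?thesis by (metis diff_mult_distrib2 diff_cancel2)
    qed
    \<comment> \<open>An interval has one element more than its length.\<close>
    also have "\<dots> < card {Min F..Max F}"
      using Min_le[OF fin Max_in[OF fin ne]] by simp
    also have "\<dots> \<le> clique_number n d \<Delta>"
      by (intro card_clique_le interval_clique F)
    finally show False using q by simp
  qed
  then show ?thesis by (auto simp: Ind_def)
qed

end

text \<open>Without divisibility the ceiling is the floor plus one; with it the two coincide and the
  extra -1 makes up the difference.\<close>

lemma ceiling_ratio:
  assumes "0 < m"
  shows "(if \<not> m dvd w then - \<lceil>real w / real m\<rceil> else - \<lceil>real w / real m\<rceil> - 1) = - int (w div m + 1)"
proof (cases "m dvd w")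
  case True
  then have "real w / real m = real (w div m)" by (simp add: real_of_nat_div)
  with True show ?thesis by simp
next
  case False
  have w: "real w = real (w div m) * real m + real (w mod m)"
    by (metis of_nat_add of_nat_mult div_mult_mod_eq)
  have "0 < w mod m" "w mod m < m" using False assms by (auto simp: dvd_eq_mod_eq_0)
  then have "0 < real (w mod m)" "real (w mod m) < real m" by simp_all
  with w have "real (w div m) * real m < real w" "real w \<le> (real (w div m) + 1) * real m"
    unfolding distrib_right by linarith+
  then have "\<lceil>real w / real m\<rceil> = int (w div m) + 1"
    using assms by (intro ceiling_unique) (simp_all add: pos_less_divide_eq pos_divide_le_eq)
  with False show ?thesis by simp
qed

theorem proposition3p6:
  fixes n d :: nat and \<Delta> \<Gamma> :: "nat set set" and R :: "'k::field S poly ring"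
    and bound :: int
  assumes "unit_interval_complex n \<Delta>"
    and "complex_dim \<Delta> = int d - 1" and "int d - 1 > 1"
    and "\<Gamma> = Ind n \<Delta>"
    and "R = toric_ring \<Gamma>"
    and "bound =
      (if \<not> (d - 1) dvd clique_number n d \<Delta>
       then - \<lceil>real (clique_number n d \<Delta>) / real (d - 1)\<rceil>
       else - \<lceil>real (clique_number n d \<Delta>) / real (d - 1)\<rceil> - 1)"
  shows "a_invariant R \<le> bound \<and>
    ({P \<in> height_one_monomial_primes R. tvar \<in> P} =
       P_ideal \<Gamma> ` {1..n} \<union> L_ideal \<Gamma> d ` maximal_cliques n d \<Delta>
     \<longrightarrow> a_invariant R = bound)"
proof -
  interpret unit_interval n d \<Delta>
    using assms(1-3) by unfold_locales simp_all
  interpret toric_complex \<Gamma> R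
    using Ind_toric_complex assms(4,5) by simp
  define w where "w = clique_number n d \<Delta>"
  \<comment> \<open>The least \<open>k\<close> with w < k(d - 1), as the next two facts
    show.\<close>
  define q where "q = w div (d - 1) + 1"
  have q: "w < q * (d - 1)"
    using d_ge dividend_less_div_times[of "d - 1" w] by (simp add: q_def)
  have q_le: "q \<le> k" if "w < k * (d - 1)" for k
    using that by (simp add: q_def less_mult_imp_div_less Suc_leI)
  have bound: "bound = - int q"
    unfolding assms(6) q_def w_def using d_ge by (intro ceiling_ratio) simp
  let ?Q = "\<lambda>j. \<exists>f :: 'k S. f \<noteq> 0 \<and> Polynomial.monom f j \<in> canonical_ideal R"
  have mon_canonical: "?Q (snd p)" if "xt_monom p \<in> canonical_ideal R" for p
  proof (intro exI conjI)
    show "Poly_Mapping.single (fst p) 1 \<noteq> (0 :: 'k S)"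
      by (metis lookup_single_eq lookup_zero zero_neq_one)
    show "Polynomial.monom (Poly_Mapping.single (fst p) 1) (snd p) \<in> canonical_ideal R"
      using that by (simp only: xt_monom_def)
  qed
  have singleton: "{i} \<in> \<Gamma> \<longleftrightarrow> i \<in> {1..n}" for i
    using small_Ind[of "{i}"] d_ge assms(4) by (auto simp: Ind_def)
  \<comment> \<open>One monomial x^a t^j of \<open>f\<close> is enough: its coordinate sum over a
    largest clique is bounded above by the clique prime and below by the coordinate primes.\<close>
  have lower: "q \<le> j" if Q: "?Q j" for j
  proof -
    obtain f :: "'k S" where f: "f \<noteq> 0" "Polynomial.monom f j \<in> canonical_ideal R" using Q by blast
    obtain a where a: "Poly_Mapping.lookup f a \<noteq> 0"
      using f(1) by (metis poly_mapping_eqI lookup_zero)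
    have supp: "(a, j) \<in> supp (Polynomial.monom f j)"
      using a by (simp add: supp_def mcoeff_def)
    obtain B where B: "B \<in> maximal_cliques n d \<Delta>" "card B = w"
      using ex_maximal_clique by (auto simp: w_def)
    then have clique: "B \<in> cliques n d \<Delta>" "d \<le> card B" by (auto simp: maximal_cliques_def)
    have "{f \<in> toric_set \<Gamma>. \<forall>p\<in>supp f. coord_sum B p < snd p * (d - 1)} \<in> height_one_monomial_primes R"
    proof (rule clique_prime_height_one)
      show "finite B" "d \<le> card B" "2 \<le> d" using clique finite_clique d_ge by auto
      show "card (F \<inter> B) \<le> d - 1" if "F \<in> \<Gamma>" for F
        using that assms(4) clique by (intro Ind_inter_clique) simp_all
      show "T \<in> \<Gamma>" if "T \<subseteq> B" "card T \<le> d - 1" for T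
        using that clique_subset[OF clique(1)] assms(4) small_Ind[of T] by auto
      show "\<exists>T\<subseteq>B. card T = d - 1 \<and> insert i T \<in> \<Gamma>" if "{i} \<in> \<Gamma>" "i \<notin> B" for i
        using that extend_maximal_clique[OF B(1)] assms(4) singleton by blast
    qed
    then have "coord_sum B (a, j) < j * (d - 1)"
      using f(2) supp by (fastforce simp: canonical_ideal_def)
    moreover have "Poly_Mapping.lookup a i > 0" if "i \<in> B" for i
      using coordinate_prime_height_one[of i] that clique_subset[OF clique(1)] singleton f(2) supp
      by (fastforce simp: canonical_ideal_def)
    then have "card B \<le> coord_sum B (a, j)"
      unfolding coord_sum_def card_eq_sum by (intro sum_mono) (simp add: Suc_leI)
    ultimately show ?thesis using B(2) q_le by simp
  qed
  have a_inv: "a_invariant R = - int (LEAST j. ?Q j)"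
    by (simp add: a_invariant_def)
  \<comment> \<open>The canonical ideal is nonzero, so the least degree is a genuine one.\<close>
  have "?Q (LEAST j. ?Q j)"
    using mon_canonical[OF canonical_ideal_nonzero] by (rule LeastI)
  then have "a_invariant R \<le> bound"
    using lower unfolding a_inv bound by simp
  moreover have "a_invariant R = bound"
    if primes: "{P \<in> height_one_monomial_primes R. tvar \<in> P} =
      P_ideal \<Gamma> ` {1..n} \<union> L_ideal \<Gamma> d ` maximal_cliques n d \<Delta>"
  proof -
    define G where "G r = {i \<in> {1..n}. i mod q = r}" for r
    have G: "G r \<in> \<Gamma>" for r
      unfolding G_def assms(4) using q by (intro residue_class_Ind) (simp add: w_def)
    have w_ge: "d \<le> w" using clique_number_ge by (simp add: w_def)
    \<comment> \<open>With at least two residue classes, every vertex is missed by one of them; this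
      is what the ideals P_i require.\<close>
    have q2: "2 \<le> q"
      using w_ge d_ge by (simp add: q_def Suc_leI div_greater_zero_iff)
    \<comment> \<open>The residue classes partition {1..n}, so this is the exponent of x_1 ... x_n
      t^q, already factored into generators. One factor in an ideal puts the whole monomial
      there.\<close>
    define p where "p = (\<Sum>r<q. face_vec (G r))"
    have in_ideal: "xt_monom p \<in> I" if "ideal I R" "r < q" "xt_monom (face_vec (G r)) \<in> I" for I r
      unfolding p_def using that G by (intro xt_monom_sum_in_ideal[of I _ r]) (auto simp: expo_face_vec)
    have generated: "xt_monom p \<in> genideal R (xset_t ` {F \<in> \<Gamma>. C F})" if "r < q" "C (G r)" for r C
    proof (rule in_ideal[OF genideal_ideal that(1)])
      show sub: "xset_t ` {F \<in> \<Gamma>. C F} \<subseteq> carrier R"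
        by (auto simp del: One_nat_def simp: xset_t_eq finite_face xt_monom_in_toric_set expo_face_vec)
      show "xt_monom (face_vec (G r)) \<in> genideal R (xset_t ` {F \<in> \<Gamma>. C F})"
        using genideal_self[OF sub] that(2) G[of r] xset_t_eq[OF finite_face[OF G[of r]], symmetric] by blast
    qed
    have "xt_monom p \<in> P" if P: "P \<in> height_one_monomial_primes R" for P
    proof (cases "tvar \<in> P")
      case False
      then obtain i where i: "{i} \<in> \<Gamma>" "\<And>F. F \<in> \<Gamma> \<Longrightarrow> i \<in> F \<Longrightarrow> xt_monom (face_vec F) \<in> P"
        using prime_without_tvar[OF P] by blast
      show ?thesis
      proof (rule in_ideal)
        show "ideal P R" using P prime_ideal by (simp add: height_one_monomial_primes_def)
        show "i mod q < q" using q2 by simp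
        show "xt_monom (face_vec (G (i mod q))) \<in> P"
          using i(1) singleton by (intro i(2) G) (auto simp: G_def)
      qed
    next
      case True
      with P have "P \<in> P_ideal \<Gamma> ` {1..n} \<union> L_ideal \<Gamma> d ` maximal_cliques n d \<Delta>"
        unfolding primes[symmetric] by simp
      then consider i where "P = P_ideal \<Gamma> i" | B where "P = L_ideal \<Gamma> d B" "B \<in> maximal_cliques n d \<Delta>"
        by blast
      then show ?thesis
      proof cases
        case 1
        have "\<exists>r<q. i mod q \<noteq> r"
          \<comment> \<open>Class 1 is chosen if i lies in class 0, and class 0 otherwise.\<close>
          using q2 by (intro exI[of _ "if i mod q = 0 then 1 else 0"]) auto
        then obtain r where "r < q" "i \<notin> G r" by (auto simp: G_def)
        then show ?thesis
          unfolding 1 P_ideal_def assms(5)[symmetric] by (rule generated)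
      next
        case 2
        then have B: "B \<in> cliques n d \<Delta>" by (simp add: maximal_cliques_def)
        \<comment> \<open>Pigeonhole: if all q disjoint classes met \<open>B\<close> in at least d -
          1 elements, then q(d - 1) would be at most |B|, hence at most w.\<close>
        have "\<exists>r<q. card (G r \<inter> B) < d - 1"
        proof (rule ccontr)
          assume "\<not> (\<exists>r<q. card (G r \<inter> B) < d - 1)"
          then have "(\<Sum>r<q. d - 1) \<le> (\<Sum>r<q. card (G r \<inter> B))"
            by (intro sum_mono) (metis lessThan_iff not_less)
          also have "\<dots> = card (\<Union>r<q. G r \<inter> B)"
            by (intro card_UN_disjoint[symmetric]) (auto simp: G_def)
          also have "\<dots> \<le> card B"
            using finite_clique[OF B] by (intro card_mono) auto
          also have "\<dots> \<le> w" unfolding w_def using B by (rule card_clique_le)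
          finally show False using q by simp
        qed
        then obtain r where "r < q" "card (G r \<inter> B) < d - 1" by blast
        then show ?thesis
          unfolding 2 L_ideal_def assms(5)[symmetric] by (rule generated)
      qed
    qed
    moreover have "xt_monom p \<in> carrier R"
      unfolding p_def using G by (simp add: xt_monom_in_toric_set expo_sum expo_face_vec)
    moreover have "snd p = q"
      by (simp add: p_def snd_sum snd_face_vec)
    ultimately have "?Q q"
      using mon_canonical[of p] by (auto simp: canonical_ideal_def)
    then have "(LEAST j. ?Q j) = q"
      by (rule Least_equality) (rule lower)
    then show ?thesis unfolding a_inv bound by simp
  qed
  ultimately show ?thesis by blast
qed

end
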